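(* Let $\{x_k\}$ be an infinite sequence generated by the SQP-type algorithm described in the context, under Assumption A, with penalty parameters $\{\rho_k\}$. Suppose that $\lim_{k\to\infty}\rho_k=\rho^*>0$ and $\lim_{k\to\infty}v_k>0$. Then every accumulation point $x^*$ of the sequence $\{x_k\}$ is an infeasible stationary point of the problem (P): minimize $f(x)$ subject to $h(x)=0$, $G(x)\preceq0$; and $x^*$ is a KKT point of the shifted problem: minimize $f(x)$ subject to $h(x)=r^*-s^*$, $G(x)\preceq t^*I_m$, where $(r^*,s^*,t^* )$ is the least shift associated with $x^*$, as defined in the context.
   Context: Notation. $\mathcal S^m$ is the space of real symmetric $m\times m$ matrices, $\langle A,B\rangle=\mathrm{tr}(AB)$, $\preceq$ is the Loewner order, $\lambda_1(A)$ is the largest eigenvalue of $A$, $[a]_+=\max\{0,a\}$ and $[a]_-=\min\{0,a\}$ (componentwise for vectors), $\circ$ is the componentwise product, $e_l=(1,\dots,1)^T\in\mathbb R^l$, $I_m$ is the identity. Data: $f:\mathbb R^n\to\mathbb R$, $h:\mathbb R^n\to\mathbb R^l$, $G:\mathbb R^n\to\mathcal S^m$; $g=\nabla f$; $Dh(x)$ is the Jacobian of $h$; $DG(x)d=\sum_i d_i\,\partial G(x)/\partial x_i$; $DG(x)^*Y=(\langle\partial G(x)/\partial x_1,Y\rangle,\dots,\langle\partial G(x)/\partial x_n,Y\rangle)^T$. Subscript $k$ means evaluation at $x_k$ ($f_k,g_k,h_k,G_k,v_k$). Constraint violation: $v(x)=\|h(x)\|_1+[\lambda_1(G(x))]_+$.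 An infeasible stationary point of (P) is a point $x$ with $v(x)>0$ that is first-order optimal for $\min_xv(x)$, i.e. for some $(\mu,Y)\in\mathbb R^l\times\mathcal S^m$: $Dh(x)^T\mu+DG(x)^*Y=0$; $(e_l-\mu)\circ[h(x)]_+=0$; $(e_l+\mu)\circ[h(x)]_-=0$; $(1-\mathrm{tr}(Y))[\lambda_1(G(x))]_+=0$; $\langle Y,G(x)-[\lambda_1(G(x))]_+I_m\rangle=0$; $-e_l\le\mu\le e_l$, $Y\succeq0$, $\mathrm{tr}(Y)\le1$. The least shift associated with $x^*$ is $(r^*,s^*,t^* )=([h(x^* )]_+,-[h(x^* )]_-,[\lambda_1(G(x^* ))]_+)$; it minimizes $e_l^T(r+s)+t$ over $r,s,t\ge0$ with $h(x^* )=r-s$, $G(x^* )\preceq tI_m$. A point $x$ is a KKT point of the shifted problem (minimize $f$ s.t. $h(x)=r^*-s^*$, $G(x)\preceq t^*I_m$) if for some $(\mu,Y)$: $g(x)+Dh(x)^T\mu+DG(x)^*Y=0$, $h(x)=r^*-s^*$, $G(x)\preceq t^*I_m$, $\langle Y,G(x)-t^*I_m\rangle=0$, $Y\succeq0$. Penalty function: $P^\rho(x)=\rho f(x)+v(x)$. Linearizations at $x_k$: $l_k^v(d)=\|h_k+Dh(x_k)d\|_1+[\lambda_1(G_k+DG(x_k)d)]_+$, $\Delta l_k^v(d)=l_k^v(0)-l_k^v(d)$, $\Delta l_k^\rho(d)=-\rho g_k^Td+\Delta l_k^v(d)$. Algorithm. Constants $\epsilon,\delta,\eta,\gamma\in(0,1)$,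 start $x_0\in\mathbb R^n$, $\rho_0>0$; positive definite matrices $B_k^{fea},B_k\in\mathcal S^n$ are given at each iteration. Iteration $k$: (1) Solve $\min_{d,r,s,t}\ e_l^T(r+s)+t+\frac12d^TB_k^{fea}d$ s.t. $h_k+Dh(x_k)d=r-s$, $G_k+DG(x_k)d\preceq tI_m$, $r\ge0,s\ge0,t\ge0$ ($r,s\in\mathbb R^l$, $t\in\mathbb R$), giving $(d_k^{fea},r_k,s_k,t_k)$ and Lagrange multipliers $(\bar\mu_{k+1},\bar Y_{k+1})\in\mathbb R^l\times\mathcal S^m$ for the equality and semidefinite constraints (Lagrangian: objective $+\mu^T(h_k+Dh(x_k)d-r+s)+\langle Y,G_k+DG(x_k)d-tI_m\rangle-\nu_r^Tr-\nu_s^Ts-\nu_tt$, with $Y\succeq0$ and $\nu_r,\nu_s,\nu_t\ge0$). (2) Solve $\min_d\ \rho_kg_k^Td+\frac12d^TB_kd$ s.t. $h_k+Dh(x_k)d=r_k-s_k$, $G_k+DG(x_k)d\preceq t_kI_m$, giving $d_k$ and Lagrange multipliers $(\hat\mu_{k+1},\hat Y_{k+1})$, which are taken to exist: $\rho_kg_k+B_kd_k+Dh(x_k)^T\hat\mu_{k+1}+DG(x_k)^*\hat Y_{k+1}=0$, $\hat Y_{k+1}\succeq0$, $\langle\hat Y_{k+1},G_k+DG(x_k)d_k-t_kI_m\rangle=0$. (3) If $d_k=0$, stop. (4) If $\rho_k(\|\bar\mu_{k+1}\|_\infty+\mathrm{tr}(\bar Y_{k+1}))>1$ or $\rho_k(\|\hat\mu_{k+1}\|_\infty+\mathrm{tr}(\hat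 Y_{k+1}))>1$, set $\rho_k'=\min\{\delta\rho_k,(1-\epsilon)/(\|\bar\mu_{k+1}\|_\infty+\mathrm{tr}(\bar Y_{k+1})+\|\hat\mu_{k+1}\|_\infty+\mathrm{tr}(\hat Y_{k+1}))\}$; otherwise $\rho_k'=\rho_k$. If $\Delta l_k^{\rho_k'}(d_k)<\epsilon\Delta l_k^v(d_k)$, set $\rho_{k+1}=\min\{\delta\rho_k',\zeta_k\}$ with $\zeta_k=(1-\epsilon)\Delta l_k^v(d_k)/(g_k^Td_k+\frac12d_k^TB_kd_k)$; otherwise $\rho_{k+1}=\rho_k'$. (5) Let $\alpha_k$ be the first $\alpha\in\{1,\gamma,\gamma^2,\dots\}$ with $P^{\rho_{k+1}}(x_k+\alpha d_k)-P^{\rho_{k+1}}(x_k)\le-\eta\alpha\Delta l_k^{\rho_{k+1}}(d_k)$; set $x_{k+1}=x_k+\alpha_kd_k$. (No cap on the number of iterations.) Assumption A. (A1) $f,h,G$ are twice continuously differentiable. (A2) There is a convex compact set $\Omega\subseteq\mathbb R^n$ with $x_k\in\Omega$ for all $k$. (A3) There are constants $0<b_1<b_2$ with $b_1\|d\|^2\le d^TB_k^{fea}d\le b_2\|d\|^2$ and $b_1\|d\|^2\le d^TB_kd\le b_2\|d\|^2$ for all $k$ and $d\in\mathbb R^n$. *)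

theory Defs
  imports "HOL-Analysis.Analysis"
begin

definition symmetric_matrix :: "real^'m^'m \<Rightarrow> bool" where
  "symmetric_matrix A \<longleftrightarrow> transpose A = A"

definition psd :: "real^'m^'m \<Rightarrow> bool" where
  "psd A \<longleftrightarrow> symmetric_matrix A \<and> (\<forall>u. 0 \<le> u \<bullet> (A *v u))"

definition pos_def :: "real^'m^'m \<Rightarrow> bool" where
  "pos_def A \<longleftrightarrow> symmetric_matrix A \<and> (\<forall>u. u \<noteq> 0 \<longrightarrow> 0 < u \<bullet> (A *v u))"

definition loewner_le :: "real^'m^'m \<Rightarrow> real^'m^'m \<Rightarrow> bool"  (infix "\<preceq>\<^sub>L" 50) where
  "A \<preceq>\<^sub>L B \<longleftrightarrow> psd (B - A)"

definition mat_inner :: "real^'m^'m \<Rightarrow> real^'m^'m \<Rightarrow> real" where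
  "mat_inner A B = trace (A ** B)"

definition eigenvalue :: "real^'m^'m \<Rightarrow> real \<Rightarrow> bool" where
  "eigenvalue A c \<longleftrightarrow> (\<exists>u. u \<noteq> 0 \<and> A *v u = c *\<^sub>R u)"

text \<open>Only meaningful for symmetric matrices, to which all uses below are confined.\<close>

definition lambda1 :: "real^'m^'m \<Rightarrow> real" where
  "lambda1 A = (GREATEST c. eigenvalue A c)"

text \<open>
  The library order, product and unit of \<^typ>\<open>real^'l\<close> are componentwise, so below
  \<open>1\<close> is the all-ones vector and \<open>*\<close> between vectors is the componentwise product.
  The maximum norm is the library's \<^const>\<open>infnorm\<close>, and \<^term>\<open>mat t\<close> is \<open>t\<close> times the
  identity matrix.
\<close>

definition norm1 :: "real^'l \<Rightarrow> real" where
  "norm1 y = (\<Sum>i\<in>UNIV. \<bar>y $ i\<bar>)"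

definition pos_part :: "real^'l \<Rightarrow> real^'l" where
  "pos_part y = (\<chi> i. max 0 (y $ i))"

definition neg_part :: "real^'l \<Rightarrow> real^'l" where
  "neg_part y = (\<chi> i. min 0 (y $ i))"

definition C2 :: "('a::real_normed_vector \<Rightarrow> 'b::real_normed_vector) \<Rightarrow> bool" where
  "C2 F \<longleftrightarrow> (\<exists>(F' :: 'a \<Rightarrow> 'a \<Rightarrow>\<^sub>L 'b) (F'' :: 'a \<Rightarrow> 'a \<Rightarrow>\<^sub>L ('a \<Rightarrow>\<^sub>L 'b)).
     (\<forall>x. (F has_derivative blinfun_apply (F' x)) (at x)) \<and>
     (\<forall>x. (F' has_derivative blinfun_apply (F'' x)) (at x)) \<and>
     continuous_on UNIV F'')"

definition partial_deriv :: "(real^'n \<Rightarrow> 'b::real_normed_vector) \<Rightarrow> 'n \<Rightarrow> real^'n \<Rightarrow> 'b" where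
  "partial_deriv F i x = frechet_derivative F (at x) (axis i 1)"

definition grad :: "(real^'n \<Rightarrow> real) \<Rightarrow> real^'n \<Rightarrow> real^'n" where
  "grad f x = (\<chi> i. partial_deriv f i x)"

abbreviation Jac :: "(real^'n \<Rightarrow> real^'l) \<Rightarrow> real^'n \<Rightarrow> real^'n^'l" where
  "Jac h x \<equiv> jacobian h (at x)"

definition DG :: "(real^'n \<Rightarrow> real^'m^'m) \<Rightarrow> real^'n \<Rightarrow> real^'n \<Rightarrow> real^'m^'m" where
  "DG G x d = (\<Sum>i\<in>UNIV. (d $ i) *\<^sub>R partial_deriv G i x)"

definition DG_adj :: "(real^'n \<Rightarrow> real^'m^'m) \<Rightarrow> real^'n \<Rightarrow> real^'m^'m \<Rightarrow> real^'n" where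
  "DG_adj G x Y = (\<chi> i. mat_inner (partial_deriv G i x) Y)"

definition violation ::
  "(real^'n \<Rightarrow> real^'l) \<Rightarrow> (real^'n \<Rightarrow> real^'m^'m) \<Rightarrow> real^'n \<Rightarrow> real" where
  "violation h G x = norm1 (h x) + max 0 (lambda1 (G x))"

definition infeasible_stationary ::
  "(real^'n \<Rightarrow> real^'l) \<Rightarrow> (real^'n \<Rightarrow> real^'m^'m) \<Rightarrow> real^'n \<Rightarrow> bool" where
  "infeasible_stationary h G x \<longleftrightarrow>
     0 < violation h G x \<and>
     (\<exists>\<mu> Y. transpose (Jac h x) *v \<mu> + DG_adj G x Y = 0 \<and>
            (1 - \<mu>) * pos_part (h x) = 0 \<and>
            (1 + \<mu>) * neg_part (h x) = 0 \<and>
            (1 - trace Y) * max 0 (lambda1 (G x)) = 0 \<and>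
            mat_inner Y (G x - mat (max 0 (lambda1 (G x)))) = 0 \<and>
            - 1 \<le> \<mu> \<and> \<mu> \<le> 1 \<and> psd Y \<and> trace Y \<le> 1)"

definition least_shift ::
  "(real^'n \<Rightarrow> real^'l) \<Rightarrow> (real^'n \<Rightarrow> real^'m^'m) \<Rightarrow> real^'n \<Rightarrow> (real^'l) \<times> (real^'l) \<times> real" where
  "least_shift h G x = (pos_part (h x), - neg_part (h x), max 0 (lambda1 (G x)))"

definition shifted_KKT_point ::
  "(real^'n \<Rightarrow> real) \<Rightarrow> (real^'n \<Rightarrow> real^'l) \<Rightarrow> (real^'n \<Rightarrow> real^'m^'m) \<Rightarrow>
   real^'l \<Rightarrow> real^'l \<Rightarrow> real \<Rightarrow> real^'n \<Rightarrow> bool" where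
  "shifted_KKT_point f h G r s t x \<longleftrightarrow>
     (\<exists>\<mu> Y. grad f x + transpose (Jac h x) *v \<mu> + DG_adj G x Y = 0 \<and>
            h x = r - s \<and>
            G x \<preceq>\<^sub>L mat t \<and>
            mat_inner Y (G x - mat t) = 0 \<and>
            psd Y)"

definition penalty ::
  "(real^'n \<Rightarrow> real) \<Rightarrow> (real^'n \<Rightarrow> real^'l) \<Rightarrow> (real^'n \<Rightarrow> real^'m^'m) \<Rightarrow>
   real \<Rightarrow> real^'n \<Rightarrow> real" where
  "penalty f h G \<rho> x = \<rho> * f x + violation h G x"

definition lin_viol ::
  "(real^'n \<Rightarrow> real^'l) \<Rightarrow> (real^'n \<Rightarrow> real^'m^'m) \<Rightarrow> real^'n \<Rightarrow> real^'n \<Rightarrow> real" where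
  "lin_viol h G x d = norm1 (h x + Jac h x *v d) + max 0 (lambda1 (G x + DG G x d))"

definition lin_viol_red ::
  "(real^'n \<Rightarrow> real^'l) \<Rightarrow> (real^'n \<Rightarrow> real^'m^'m) \<Rightarrow> real^'n \<Rightarrow> real^'n \<Rightarrow> real" where
  "lin_viol_red h G x d = lin_viol h G x 0 - lin_viol h G x d"

definition lin_pen_red ::
  "(real^'n \<Rightarrow> real) \<Rightarrow> (real^'n \<Rightarrow> real^'l) \<Rightarrow> (real^'n \<Rightarrow> real^'m^'m) \<Rightarrow>
   real^'n \<Rightarrow> real \<Rightarrow> real^'n \<Rightarrow> real" where
  "lin_pen_red f h G x \<rho> d = - \<rho> * (grad f x \<bullet> d) + lin_viol_red h G x d"

definition fea_feasible ::
  "(real^'n \<Rightarrow> real^'l) \<Rightarrow> (real^'n \<Rightarrow> real^'m^'m) \<Rightarrow> real^'n \<Rightarrow>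
   real^'n \<Rightarrow> real^'l \<Rightarrow> real^'l \<Rightarrow> real \<Rightarrow> bool" where
  "fea_feasible h G x d r s t \<longleftrightarrow>
     h x + Jac h x *v d = r - s \<and> G x + DG G x d \<preceq>\<^sub>L mat t \<and> 0 \<le> r \<and> 0 \<le> s \<and> 0 \<le> t"

definition fea_obj ::
  "real^'n^'n \<Rightarrow> real^'n \<Rightarrow> real^'l \<Rightarrow> real^'l \<Rightarrow> real \<Rightarrow> real" where
  "fea_obj B d r s t = 1 \<bullet> (r + s) + t + 1/2 * (d \<bullet> (B *v d))"

definition fea_solution ::
  "(real^'n \<Rightarrow> real^'l) \<Rightarrow> (real^'n \<Rightarrow> real^'m^'m) \<Rightarrow> real^'n \<Rightarrow> real^'n^'n \<Rightarrow>
   real^'n \<Rightarrow> real^'l \<Rightarrow> real^'l \<Rightarrow> real \<Rightarrow> bool" where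
  "fea_solution h G x B d r s t \<longleftrightarrow>
     fea_feasible h G x d r s t \<and>
     (\<forall>d' r' s' t'. fea_feasible h G x d' r' s' t' \<longrightarrow> fea_obj B d r s t \<le> fea_obj B d' r' s' t')"

definition fea_lagrangian ::
  "(real^'n \<Rightarrow> real^'l) \<Rightarrow> (real^'n \<Rightarrow> real^'m^'m) \<Rightarrow> real^'n \<Rightarrow> real^'n^'n \<Rightarrow>
   real^'l \<Rightarrow> real^'m^'m \<Rightarrow> real^'l \<Rightarrow> real^'l \<Rightarrow> real \<Rightarrow>
   real^'n \<Rightarrow> real^'l \<Rightarrow> real^'l \<Rightarrow> real \<Rightarrow> real" where
  "fea_lagrangian h G x B \<mu> Y \<nu>r \<nu>s \<nu>t d r s t =
     fea_obj B d r s t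
     + \<mu> \<bullet> (h x + Jac h x *v d - r + s)
     + mat_inner Y (G x + DG G x d - mat t)
     - \<nu>r \<bullet> r - \<nu>s \<bullet> s - \<nu>t * t"

definition fea_multipliers ::
  "(real^'n \<Rightarrow> real^'l) \<Rightarrow> (real^'n \<Rightarrow> real^'m^'m) \<Rightarrow> real^'n \<Rightarrow> real^'n^'n \<Rightarrow>
   real^'n \<Rightarrow> real^'l \<Rightarrow> real^'l \<Rightarrow> real \<Rightarrow> real^'l \<Rightarrow> real^'m^'m \<Rightarrow> bool" where
  "fea_multipliers h G x B d r s t \<mu> Y \<longleftrightarrow>
     psd Y \<and> mat_inner Y (G x + DG G x d - mat t) = 0 \<and>
     (\<exists>\<nu>r \<nu>s \<nu>t. 0 \<le> \<nu>r \<and> 0 \<le> \<nu>s \<and> 0 \<le> \<nu>t \<and>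
        \<nu>r * r = 0 \<and> \<nu>s * s = 0 \<and> \<nu>t * t = 0 \<and>
        ((\<lambda>(d, r, s, t). fea_lagrangian h G x B \<mu> Y \<nu>r \<nu>s \<nu>t d r s t)
           has_derivative (\<lambda>_. 0)) (at (d, r, s, t)))"

definition opt_feasible ::
  "(real^'n \<Rightarrow> real^'l) \<Rightarrow> (real^'n \<Rightarrow> real^'m^'m) \<Rightarrow> real^'n \<Rightarrow>
   real^'l \<Rightarrow> real^'l \<Rightarrow> real \<Rightarrow> real^'n \<Rightarrow> bool" where
  "opt_feasible h G x r s t d \<longleftrightarrow>
     h x + Jac h x *v d = r - s \<and> G x + DG G x d \<preceq>\<^sub>L mat t"

definition opt_obj ::
  "(real^'n \<Rightarrow> real) \<Rightarrow> real^'n \<Rightarrow> real \<Rightarrow> real^'n^'n \<Rightarrow> real^'n \<Rightarrow> real" where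
  "opt_obj f x \<rho> B d = \<rho> * (grad f x \<bullet> d) + 1/2 * (d \<bullet> (B *v d))"

definition opt_solution ::
  "(real^'n \<Rightarrow> real) \<Rightarrow> (real^'n \<Rightarrow> real^'l) \<Rightarrow> (real^'n \<Rightarrow> real^'m^'m) \<Rightarrow> real^'n \<Rightarrow> real \<Rightarrow>
   real^'n^'n \<Rightarrow> real^'l \<Rightarrow> real^'l \<Rightarrow> real \<Rightarrow> real^'n \<Rightarrow> bool" where
  "opt_solution f h G x \<rho> B r s t d \<longleftrightarrow>
     opt_feasible h G x r s t d \<and>
     (\<forall>d'. opt_feasible h G x r s t d' \<longrightarrow> opt_obj f x \<rho> B d \<le> opt_obj f x \<rho> B d')"

definition opt_multipliers ::
  "(real^'n \<Rightarrow> real) \<Rightarrow> (real^'n \<Rightarrow> real^'l) \<Rightarrow> (real^'n \<Rightarrow> real^'m^'m) \<Rightarrow> real^'n \<Rightarrow> real \<Rightarrow>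
   real^'n^'n \<Rightarrow> real \<Rightarrow> real^'n \<Rightarrow> real^'l \<Rightarrow> real^'m^'m \<Rightarrow> bool" where
  "opt_multipliers f h G x \<rho> B t d \<mu> Y \<longleftrightarrow>
     \<rho> *\<^sub>R grad f x + B *v d + transpose (Jac h x) *v \<mu> + DG_adj G x Y = 0 \<and>
     psd Y \<and> mat_inner Y (G x + DG G x d - mat t) = 0"

text \<open>
  The multipliers carry the index \<open>k + 1\<close> in the usual
  presentation, but they are computed in iteration \<open>k\<close> and are stored there.
\<close>

record ('n, 'l, 'm) sqp_iterate =
  it_x :: "real^'n"
  it_rho :: real
  it_Bfea :: "real^'n^'n"
  it_B :: "real^'n^'n"
  it_dfea :: "real^'n"
  it_r :: "real^'l"
  it_s :: "real^'l"
  it_t :: real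
  it_mubar :: "real^'l"
  it_Ybar :: "real^'m^'m"
  it_d :: "real^'n"
  it_muhat :: "real^'l"
  it_Yhat :: "real^'m^'m"
  it_alpha :: real

definition rho_mid :: "real \<Rightarrow> real \<Rightarrow> ('n::finite, 'l::finite, 'm::finite) sqp_iterate \<Rightarrow> real" where
  "rho_mid \<epsilon> \<delta> I =
     (let Nbar = infnorm (it_mubar I) + trace (it_Ybar I);
          Nhat = infnorm (it_muhat I) + trace (it_Yhat I)
      in if it_rho I * Nbar > 1 \<or> it_rho I * Nhat > 1
         then min (\<delta> * it_rho I) ((1 - \<epsilon>) / (Nbar + Nhat))
         else it_rho I)"

definition rho_next ::
  "(real^'n \<Rightarrow> real) \<Rightarrow> (real^'n \<Rightarrow> real^'l) \<Rightarrow> (real^'n \<Rightarrow> real^'m^'m) \<Rightarrow>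
   real \<Rightarrow> real \<Rightarrow> ('n::finite, 'l::finite, 'm::finite) sqp_iterate \<Rightarrow> real" where
  "rho_next f h G \<epsilon> \<delta> I =
     (let x = it_x I; d = it_d I; \<rho>' = rho_mid \<epsilon> \<delta> I;
          \<zeta> = (1 - \<epsilon>) * lin_viol_red h G x d / (grad f x \<bullet> d + 1/2 * (d \<bullet> (it_B I *v d)))
      in if lin_pen_red f h G x \<rho>' d < \<epsilon> * lin_viol_red h G x d
         then min (\<delta> * \<rho>') \<zeta>
         else \<rho>')"

definition sufficient_decrease ::
  "(real^'n \<Rightarrow> real) \<Rightarrow> (real^'n \<Rightarrow> real^'l) \<Rightarrow> (real^'n \<Rightarrow> real^'m^'m) \<Rightarrow>
   real \<Rightarrow> real \<Rightarrow> real^'n \<Rightarrow> real^'n \<Rightarrow> real \<Rightarrow> bool" where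
  "sufficient_decrease f h G \<eta> \<rho> x d \<alpha> \<longleftrightarrow>
     penalty f h G \<rho> (x + \<alpha> *\<^sub>R d) - penalty f h G \<rho> x \<le> - \<eta> * \<alpha> * lin_pen_red f h G x \<rho> d"

definition backtracking_step ::
  "(real^'n \<Rightarrow> real) \<Rightarrow> (real^'n \<Rightarrow> real^'l) \<Rightarrow> (real^'n \<Rightarrow> real^'m^'m) \<Rightarrow>
   real \<Rightarrow> real \<Rightarrow> real \<Rightarrow> real^'n \<Rightarrow> real^'n \<Rightarrow> real \<Rightarrow> bool" where
  "backtracking_step f h G \<eta> \<gamma> \<rho> x d \<alpha> \<longleftrightarrow>
     (\<exists>j. \<alpha> = \<gamma> ^ j \<and> sufficient_decrease f h G \<eta> \<rho> x d (\<gamma> ^ j) \<and>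
          (\<forall>i<j. \<not> sufficient_decrease f h G \<eta> \<rho> x d (\<gamma> ^ i)))"

text \<open>
  The algorithm terminates at a zero step, hence \<open>it_d I \<noteq> 0\<close>; \<open>x'\<close> and \<open>\<rho>'\<close> are the point
  and the penalty parameter of the next iteration.
\<close>

definition sqp_step ::
  "(real^'n \<Rightarrow> real) \<Rightarrow> (real^'n \<Rightarrow> real^'l) \<Rightarrow> (real^'n \<Rightarrow> real^'m^'m) \<Rightarrow>
   real \<Rightarrow> real \<Rightarrow> real \<Rightarrow> real \<Rightarrow> ('n::finite, 'l::finite, 'm::finite) sqp_iterate \<Rightarrow>
   real^'n \<Rightarrow> real \<Rightarrow> bool" where
  "sqp_step f h G \<epsilon> \<delta> \<eta> \<gamma> I x' \<rho>' \<longleftrightarrow>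
     pos_def (it_Bfea I) \<and> pos_def (it_B I) \<and>
     fea_solution h G (it_x I) (it_Bfea I) (it_dfea I) (it_r I) (it_s I) (it_t I) \<and>
     fea_multipliers h G (it_x I) (it_Bfea I) (it_dfea I) (it_r I) (it_s I) (it_t I)
       (it_mubar I) (it_Ybar I) \<and>
     opt_solution f h G (it_x I) (it_rho I) (it_B I) (it_r I) (it_s I) (it_t I) (it_d I) \<and>
     opt_multipliers f h G (it_x I) (it_rho I) (it_B I) (it_t I) (it_d I)
       (it_muhat I) (it_Yhat I) \<and>
     it_d I \<noteq> 0 \<and>
     \<rho>' = rho_next f h G \<epsilon> \<delta> I \<and>
     backtracking_step f h G \<eta> \<gamma> \<rho>' (it_x I) (it_d I) (it_alpha I) \<and>
     x' = it_x I + it_alpha I *\<^sub>R it_d I"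

definition sqp_infinite_run ::
  "(real^'n \<Rightarrow> real) \<Rightarrow> (real^'n \<Rightarrow> real^'l) \<Rightarrow> (real^'n \<Rightarrow> real^'m^'m) \<Rightarrow>
   real \<Rightarrow> real \<Rightarrow> real \<Rightarrow> real \<Rightarrow>
   (nat \<Rightarrow> ('n::finite, 'l::finite, 'm::finite) sqp_iterate) \<Rightarrow> bool" where
  "sqp_infinite_run f h G \<epsilon> \<delta> \<eta> \<gamma> run \<longleftrightarrow>
     0 < it_rho (run 0) \<and>
     (\<forall>k. sqp_step f h G \<epsilon> \<delta> \<eta> \<gamma> (run k) (it_x (run (Suc k))) (it_rho (run (Suc k))))"

definition accumulation_point :: "(nat \<Rightarrow> 'a::topological_space) \<Rightarrow> 'a \<Rightarrow> bool" where
  "accumulation_point X p \<longleftrightarrow> (\<exists>\<phi>. strict_mono \<phi> \<and> (X \<circ> \<phi>) \<longlonglongrightarrow> p)"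

definition uniformly_elliptic :: "real \<Rightarrow> real \<Rightarrow> real^'n^'n \<Rightarrow> bool" where
  "uniformly_elliptic b1 b2 B \<longleftrightarrow>
     (\<forall>d. b1 * (norm d)\<^sup>2 \<le> d \<bullet> (B *v d) \<and> d \<bullet> (B *v d) \<le> b2 * (norm d)\<^sup>2)"

end

theory Submission
  imports Defs
begin

text \<open>
  The penalty parameter is multiplied by at most \<open>\<delta> < 1\<close> whenever it changes, so a positive limit
  means that it is eventually constant (lemmas \<open>rho_next_cases\<close> and
  \<open>eventually_no_geometric_reduction\<close>). From then on both tests that trigger a change fail: the
  multipliers of the second subproblem are bounded by \<open>1 / \<rho>\<close>, and the predicted reduction of the
  penalty function is at least \<open>\<epsilon>\<close> times the predicted reduction of the linearized violation. The
  multipliers of the first subproblem are always bounded, since the problem penalizes its slack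
  variables with weight one.

  The core of the proof is that both steps tend to zero; call them \<open>e\<close> (feasibility) and \<open>d\<close>
  (optimality). The linear reduction of the violation achieved by \<open>d\<close> is at least
  \<open>1/2 (e \<bullet> B e)\<close> (\<open>fea_solution_lin_viol_red\<close>), and by duality
  \<open>d \<bullet> B d \<le> - \<rho> (grad f \<bullet> d) + O(|e|)\<close> (\<open>opt_step_energy\<close>). The first estimate bounds \<open>e\<close>, the second then
  bounds \<open>d\<close>. On bounded steps the penalty function exceeds its linearized model by at most a
  uniform quadratic error (\<open>penalty_model_decrease\<close>), so backtracking gives a step length that is
  either one or at least proportional to the predicted reduction. As the penalty function is fixed
  and bounded below along the run, the predicted reduction tends to zero
  (\<open>Armijo_decrease_tendsto_0\<close>). Hence the predicted reduction of the violation tends to zero, hence \<open>e\<close>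
  does, and the two estimates together force \<open>d\<close> to zero.

  Given an accumulation point, choose a subsequence along which all multipliers and model matrices
  converge. Because the steps vanish, the optimality conditions of the two subproblems
  become in the limit the conditions for infeasible stationarity
  (\<open>infeasible_stationary_limit\<close>) and for a KKT point of the least-shifted problem
  (\<open>shifted_KKT_limit\<close>). The violation at the accumulation point is positive by continuity.

  The eigenvalue enters only through the variational characterization in
  \<open>lambda1_Rayleigh\<close>, which yields convexity, Lipschitz continuity and the equivalence of
  \<open>A \<preceq>\<^sub>L mat t\<close> with \<open>lambda1 A \<le> t\<close>.
\<close>

section \<open>Positive semidefinite matrices\<close>

lemma mat_vector_mult: "mat t *v u = t *\<^sub>R (u :: real^'m)"
  by (simp add: vec_eq_iff matrix_vector_mult_def mat_def if_distrib[of "\<lambda>x. x * _"] sum.delta cong: if_cong)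

lemma symmetric_matrix_inner:
  assumes "symmetric_matrix A"
  shows "u \<bullet> (A *v w) = w \<bullet> (A *v u)"
proof -
  have "u \<bullet> (A *v w) = (u v* A) \<bullet> w"
    by (rule dot_lmul_matrix[symmetric])
  also have "u v* A = A *v u"
    using assms by (metis symmetric_matrix_def transpose_matrix_vector)
  finally show ?thesis
    by (simp add: inner_commute)
qed

lemma symmetric_matrix_add: "symmetric_matrix A \<Longrightarrow> symmetric_matrix B \<Longrightarrow> symmetric_matrix (A + B)"
  and symmetric_matrix_diff: "symmetric_matrix A \<Longrightarrow> symmetric_matrix B \<Longrightarrow> symmetric_matrix (A - B)"
  and symmetric_matrix_scaleR: "symmetric_matrix A \<Longrightarrow> symmetric_matrix (c *\<^sub>R A)"
  and symmetric_matrix_mat: "symmetric_matrix (mat t)"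
  by (auto simp: symmetric_matrix_def transpose_def vec_eq_iff mat_def)

lemma quadratic_form_add:
  assumes "symmetric_matrix A"
  shows "(u + c *\<^sub>R w) \<bullet> (A *v (u + c *\<^sub>R w)) = u \<bullet> (A *v u) + 2 * c * (u \<bullet> (A *v w)) + c\<^sup>2 * (w \<bullet> (A *v w))"
  using symmetric_matrix_inner[OF assms, of w u]
  by (simp add: matrix_vector_right_distrib matrix_vector_mult_scaleR inner_add_left inner_add_right
      power2_eq_square algebra_simps)

text \<open>The quadratic \<open>c \<mapsto> (u + c w) \<bullet> A (u + c w)\<close> never becomes negative; evaluating it at its minimizer
gives the inequality. If its leading coefficient vanishes it is affine, and then constant.\<close>

lemma psd_Cauchy_Schwarz:
  assumes "psd A"
  shows "(u \<bullet> (A *v w))\<^sup>2 \<le> (u \<bullet> (A *v u)) * (w \<bullet> (A *v w))"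
proof -
  let ?a = "u \<bullet> (A *v u)" and ?b = "u \<bullet> (A *v w)" and ?c = "w \<bullet> (A *v w)"
  have sym: "symmetric_matrix A" and nn: "0 \<le> y \<bullet> (A *v y)" for y
    using assms by (auto simp: psd_def)
  have q: "0 \<le> ?a + 2 * x * ?b + x\<^sup>2 * ?c" for x
    using nn[of "u + x *\<^sub>R w"] quadratic_form_add[OF sym, of u x w] by simp
  show ?thesis
  proof (cases "?c = 0")
    case True
    have "?b = 0"
    proof (rule ccontr)
      assume "?b \<noteq> 0"
      \<comment> \<open>an affine function bounded below is constant\<close>
      with q[of "- (?a + 1) / (2 * ?b)"] True show False by (simp add: field_simps)
    qed
    with True show ?thesis by simp
  next
    case False
    then have "0 < ?c" using nn[of w] by simp
    with q[of "- ?b / ?c"] show ?thesis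
      by (simp add: power2_eq_square field_simps)
  qed
qed

lemma psd_kernel: "psd A \<Longrightarrow> w \<bullet> (A *v w) = 0 \<Longrightarrow> A *v w = 0"
  using psd_Cauchy_Schwarz[of A "A *v w" w] by simp

lemma axis_inner_matrix: "axis i 1 \<bullet> (A *v axis j 1) = (A :: real^'m^'m) $ i $ j"
  by (simp add: inner_axis' matrix_vector_mul_component inner_axis)

lemma psd_diag_nonneg: "psd A \<Longrightarrow> 0 \<le> A $ i $ i"
  using axis_inner_matrix[of i A i] by (metis psd_def)

lemma psd_trace_nonneg: "psd A \<Longrightarrow> 0 \<le> trace A"
  by (simp add: trace_def psd_diag_nonneg sum_nonneg)

text \<open>A psd matrix is controlled by its trace alone. The trace is the quantity that the penalty
update compares with \<open>1 / \<rho>\<close>, so this is what makes the matrix multipliers bounded.\<close>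

lemma psd_entry_le_trace:
  assumes "psd A"
  shows "\<bar>A $ i $ j\<bar> \<le> trace A"
proof -
  have diag: "A $ k $ k \<le> trace A" for k
    unfolding trace_def by (rule member_le_sum) (auto simp: psd_diag_nonneg assms)
  have "(A $ i $ j)\<^sup>2 \<le> A $ i $ i * A $ j $ j"
    using psd_Cauchy_Schwarz[OF assms, of "axis i 1" "axis j 1"] by (simp add: axis_inner_matrix)
  also have "\<dots> \<le> trace A * trace A"
    by (intro mult_mono diag psd_trace_nonneg psd_diag_nonneg assms)
  finally show ?thesis
    using psd_trace_nonneg[OF assms] by (simp add: abs_le_square_iff[symmetric] power2_eq_square[symmetric])
qed

lemma norm_le_if_entries_le:
  fixes A :: "real^'n^'m"
  assumes "\<And>i j. \<bar>A $ i $ j\<bar> \<le> c"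
  shows "norm A \<le> real CARD('m) * (real CARD('n) * c)"
proof -
  have row: "norm (A $ i) \<le> real CARD('n) * c" for i
  proof -
    have "norm (A $ i) \<le> (\<Sum>j\<in>UNIV. \<bar>A $ i $ j\<bar>)"
      by (rule norm_le_l1_cart)
    also have "\<dots> \<le> (\<Sum>j\<in>(UNIV::'n set). c)"
      by (intro sum_mono assms)
    finally show ?thesis by simp
  qed
  have "norm A \<le> (\<Sum>i\<in>UNIV. norm (A $ i))"
    unfolding norm_vec_def by (rule L2_set_le_sum) simp
  also have "\<dots> \<le> (\<Sum>i\<in>(UNIV::'m set). real CARD('n) * c)"
    by (intro sum_mono row)
  finally show ?thesis by simp
qed

lemma norm_psd_le_trace:
  fixes A :: "real^'m^'m"
  assumes "psd A"
  shows "norm A \<le> real CARD('m) * (real CARD('m) * trace A)"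
  by (intro norm_le_if_entries_le psd_entry_le_trace assms)

lemma norm_elliptic_le:
  fixes B :: "real^'n^'n"
  assumes "psd B" "uniformly_elliptic b1 b2 B"
  shows "norm B \<le> real CARD('n) * (real CARD('n) * (real CARD('n) * b2))"
proof -
  have "B $ i $ i \<le> b2" for i
    using assms(2)[unfolded uniformly_elliptic_def, rule_format, of "axis i 1"]
    by (simp add: axis_inner_matrix)
  then have "trace B \<le> (\<Sum>i\<in>(UNIV::'n set). b2)"
    unfolding trace_def by (intro sum_mono)
  then have "trace B \<le> real CARD('n) * b2" by simp
  then show ?thesis
    by (intro order_trans[OF norm_psd_le_trace[OF assms(1)]] mult_left_mono) auto
qed

lemma norm_le_if_components_le:
  fixes y :: "real^'l"
  assumes "\<And>i. \<bar>y $ i\<bar> \<le> c"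
  shows "norm y \<le> real CARD('l) * c"
proof -
  have "norm y \<le> (\<Sum>j\<in>UNIV. \<bar>y $ j\<bar>)"
    by (rule norm_le_l1_cart)
  also have "\<dots> \<le> (\<Sum>j\<in>(UNIV::'l set). c)"
    by (intro sum_mono assms)
  finally show ?thesis by simp
qed

lemma psd_scaleR: "psd Y \<Longrightarrow> 0 \<le> c \<Longrightarrow> psd (c *\<^sub>R Y)"
  by (auto simp: psd_def symmetric_matrix_scaleR scaleR_matrix_vector_assoc[symmetric])

lemma mat_inner_eq_sum: "mat_inner A B = (\<Sum>i\<in>UNIV. \<Sum>j\<in>UNIV. A $ i $ j * B $ j $ i)"
  by (simp add: mat_inner_def trace_def matrix_matrix_mult_def)

lemma mat_inner_commute: "mat_inner A B = mat_inner B A"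
  unfolding mat_inner_def by (rule trace_mul_sym)

lemma mat_inner_bilinear:
  "mat_inner A (B + C) = mat_inner A B + mat_inner A C"
  "mat_inner A (B - C) = mat_inner A B - mat_inner A C"
  "mat_inner A (c *\<^sub>R B) = c * mat_inner A B"
  "mat_inner (A + A') B = mat_inner A B + mat_inner A' B"
  "mat_inner (A - A') B = mat_inner A B - mat_inner A' B"
  "mat_inner (c *\<^sub>R A) B = c * mat_inner A B"
  by (simp_all add: mat_inner_eq_sum algebra_simps sum.distrib sum_subtractf sum_distrib_left)

lemma mat_inner_sum: "mat_inner A (\<Sum>i\<in>S. B i) = (\<Sum>i\<in>S. mat_inner A (B i))"
  by (induction S rule: infinite_finite_induct)
    (simp_all add: mat_inner_bilinear, simp_all add: mat_inner_eq_sum)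

lemma mat_inner_mat: "mat_inner A (mat t) = t * trace A"
  by (simp add: mat_inner_eq_sum trace_def mat_def if_distrib[of "\<lambda>x. _ * x"] sum.delta sum_distrib_left
      mult.commute cong: if_cong)

lemma abs_mat_inner_le:
  assumes "\<And>i j. \<bar>A $ i $ j\<bar> \<le> c"
  shows "\<bar>mat_inner A B\<bar> \<le> (real CARD('m))\<^sup>2 * c * norm (B :: real^'m^'m)"
proof -
  have "\<bar>A $ i $ j * B $ j $ i\<bar> \<le> c * norm B" for i j
    unfolding abs_mult
    using component_le_norm_cart[of "B $ j" i] Finite_Cartesian_Product.norm_nth_le[of B j] assms[of i j]
    by (intro mult_mono) (auto intro: order_trans)
  then have "\<bar>mat_inner A B\<bar> \<le> (\<Sum>i\<in>(UNIV::'m set). \<Sum>j\<in>(UNIV::'m set). c * norm B)"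
    unfolding mat_inner_eq_sum by (intro order_trans[OF sum_abs] sum_mono order_trans[OF sum_abs]) auto
  then show ?thesis
    by (simp add: power2_eq_square mult.assoc)
qed

lemma tendsto_mat_inner [tendsto_intros]:
  assumes "(A \<longlongrightarrow> a) F" "(B \<longlongrightarrow> b) F"
  shows "((\<lambda>k. mat_inner (A k) (B k)) \<longlongrightarrow> mat_inner a b) F"
  unfolding mat_inner_eq_sum using assms by (intro tendsto_intros)

lemma tendsto_matrix_vector_mult [tendsto_intros]:
  fixes A :: "_ \<Rightarrow> real^'n^'m"
  assumes "(A \<longlongrightarrow> a) F" "(u \<longlongrightarrow> w) F"
  shows "((\<lambda>k. A k *v u k) \<longlongrightarrow> a *v w) F"
  unfolding matrix_vector_mult_def using assms by (intro tendsto_intros)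

lemma tendsto_transpose [tendsto_intros]:
  fixes A :: "_ \<Rightarrow> real^'n^'m"
  assumes "(A \<longlongrightarrow> a) F"
  shows "((\<lambda>k. transpose (A k)) \<longlongrightarrow> transpose a) F"
  unfolding transpose_def using assms by (intro tendsto_intros)

lemma tendsto_mat [tendsto_intros]:
  fixes t :: "_ \<Rightarrow> real"
  assumes "(t \<longlongrightarrow> t') F"
  shows "((\<lambda>k. mat (t k) :: real^'m^'m) \<longlongrightarrow> mat t') F"
  unfolding mat_def
proof (intro tendsto_vec_lambda)
  show "((\<lambda>k. if i = j then t k else 0) \<longlongrightarrow> (if i = j then t' else 0)) F" for i j :: 'm
    using assms by (cases "i = j") auto
qed

lemma tendsto_trace [tendsto_intros]:
  fixes A :: "_ \<Rightarrow> real^'m^'m"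
  assumes "(A \<longlongrightarrow> a) F"
  shows "((\<lambda>k. trace (A k)) \<longlongrightarrow> trace a) F"
  unfolding trace_def using assms by (intro tendsto_intros)

lemma psd_limit:
  assumes "\<And>k. psd (A k)" "A \<longlonglongrightarrow> a"
  shows "psd a"
  unfolding psd_def
proof (intro conjI allI)
  have "(\<lambda>k. transpose (A k)) \<longlonglongrightarrow> transpose a"
    using assms(2) by (rule tendsto_transpose)
  moreover have "(\<lambda>k. transpose (A k)) = A"
    using assms(1) by (auto simp: psd_def symmetric_matrix_def)
  ultimately show "symmetric_matrix a"
    using assms(2) LIMSEQ_unique by (auto simp: symmetric_matrix_def)
  show "0 \<le> u \<bullet> (a *v u)" for u
  proof (rule LIMSEQ_le_const)
    show "(\<lambda>k. u \<bullet> (A k *v u)) \<longlonglongrightarrow> u \<bullet> (a *v u)"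
      using assms(2) by (intro tendsto_intros)
  qed (use assms(1) in \<open>auto simp: psd_def\<close>)
qed

text \<open>One step of symmetric elimination: subtracting the rank-one matrix built from row \<open>i\<close> leaves the
Schur complement of the pivot, bordered by zeros. Its quadratic form is nonnegative because of the
Cauchy-Schwarz inequality for \<open>A\<close>.\<close>

lemma psd_deflate:
  fixes A :: "real^'m^'m"
  assumes A: "psd A" and i: "A $ i $ i \<noteq> 0"
  shows "psd (\<chi> p q. A $ p $ q - A $ i $ p * A $ i $ q / A $ i $ i)" (is "psd ?A'")
proof -
  have entry: "A $ p $ q = A $ q $ p" for p q
    using A unfolding psd_def symmetric_matrix_def transpose_def vec_eq_iff by auto
  have pos: "0 < A $ i $ i"
    using psd_diag_nonneg[OF A, of i] i by simp
  have form: "u \<bullet> (?A' *v u) = u \<bullet> (A *v u) - (axis i 1 \<bullet> (A *v u))\<^sup>2 / A $ i $ i" for u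
  proof -
    have "u \<bullet> (?A' *v u) = (\<Sum>p\<in>UNIV. \<Sum>q\<in>UNIV. u $ p * A $ p $ q * u $ q)
        - (\<Sum>p\<in>UNIV. \<Sum>q\<in>UNIV. (A $ i $ p * u $ p) * (A $ i $ q * u $ q)) / A $ i $ i"
      by (simp add: inner_vec_def matrix_vector_mult_def sum_distrib_left
          sum_divide_distrib sum_subtractf[symmetric] algebra_simps)
    also have "\<dots> = u \<bullet> (A *v u) - (A $ i \<bullet> u) * (A $ i \<bullet> u) / A $ i $ i"
      unfolding sum_product[symmetric] by (simp add: inner_vec_def matrix_vector_mult_def sum_distrib_left mult.assoc)
    finally show ?thesis
      by (simp add: power2_eq_square inner_axis' matrix_vector_mul_component)
  qed
  show ?thesis
    unfolding psd_def
  proof (intro conjI allI)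
    show "symmetric_matrix ?A'"
      unfolding symmetric_matrix_def transpose_def vec_eq_iff
      using entry by (simp add: mult.commute)
    show "0 \<le> u \<bullet> (?A' *v u)" for u
      unfolding form using psd_Cauchy_Schwarz[OF A, of "axis i 1" u] pos
      by (simp add: axis_inner_matrix field_simps)
  qed
qed

text \<open>One half of the self-duality of the psd cone. Each elimination step splits off a term
\<open>a \<bullet> M a / A\<^sub>i\<^sub>i \<ge> 0\<close>, where \<open>a\<close> is row \<open>i\<close> of \<open>A\<close>, and clears that row without
filling rows that were already zero, so induction on the number of nonzero rows replaces the
spectral decomposition.\<close>

lemma mat_inner_psd_nonneg:
  fixes A M :: "real^'m^'m"
  assumes "psd A" "psd M"
  shows "0 \<le> mat_inner A M"
  using assms(1)
proof (induction "card {i. A $ i \<noteq> 0}" arbitrary: A rule: less_induct)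
  case less
  show ?case
  proof (cases "\<exists>i. A $ i $ i \<noteq> 0")
    case False
    \<comment> \<open>a psd matrix with zero diagonal vanishes\<close>
    have "A $ p $ q = 0" for p q
      using psd_Cauchy_Schwarz[OF less.prems, of "axis p 1" "axis q 1"] False by (simp add: axis_inner_matrix)
    then show ?thesis by (simp add: mat_inner_eq_sum)
  next
    case True
    then obtain i where i: "A $ i $ i \<noteq> 0" by blast
    define A' where "A' = (\<chi> p q. A $ p $ q - A $ i $ p * A $ i $ q / A $ i $ i)"
    have psd': "psd A'"
      unfolding A'_def by (rule psd_deflate[OF less.prems i])
    have "A' $ i = 0"
      using i by (simp add: A'_def vec_eq_iff)
    moreover have "A $ i \<noteq> 0"
      using i by (auto simp: vec_eq_iff)
    moreover have "A' $ p = 0" if "A $ p = 0" for p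
    proof -
      have "A $ i $ p = A $ p $ i"
        using less.prems unfolding psd_def symmetric_matrix_def transpose_def vec_eq_iff by auto
      with that show ?thesis by (simp add: A'_def vec_eq_iff)
    qed
    ultimately have "{p. A' $ p \<noteq> 0} \<subset> {p. A $ p \<noteq> 0}"
      by blast
    then have IH: "0 \<le> mat_inner A' M"
      by (intro less.hyps psd' psubset_card_mono) auto
    have "mat_inner A M = mat_inner A' M + (A $ i \<bullet> (M *v A $ i)) / A $ i $ i"
    proof -
      have "A $ i \<bullet> (M *v A $ i) = (\<Sum>q\<in>UNIV. \<Sum>p\<in>UNIV. A $ i $ q * M $ q $ p * A $ i $ p)"
        by (simp add: inner_vec_def matrix_vector_mult_def sum_distrib_left mult.assoc)
      also have "\<dots> = (\<Sum>p\<in>UNIV. \<Sum>q\<in>UNIV. A $ i $ p * A $ i $ q * M $ q $ p)"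
        by (subst sum.swap) (simp add: mult_ac)
      finally show ?thesis
        by (simp add: mat_inner_eq_sum A'_def sum_divide_distrib sum.distrib[symmetric] algebra_simps)
    qed
    moreover have "0 \<le> (A $ i \<bullet> (M *v A $ i)) / A $ i $ i"
      using assms(2) psd_diag_nonneg[OF less.prems, of i] by (auto simp: psd_def)
    ultimately show ?thesis using IH by simp
  qed
qed

section \<open>The largest eigenvalue\<close>

text \<open>Let \<open>w\<close> maximize \<open>u \<bullet> A u\<close> on the unit sphere, with value \<open>c\<close>. Then \<open>c I - A\<close> is psd and its quadratic
form vanishes at \<open>w\<close>, so \<open>w\<close> lies in its kernel: \<open>c\<close> is an eigenvalue. Testing \<open>c I - A\<close> on any other
eigenvector shows that no eigenvalue is larger.\<close>

lemma lambda1_Rayleigh: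
  fixes A :: "real^'m^'m"
  assumes A: "symmetric_matrix A"
  shows lambda1_attained: "\<exists>u. norm u = 1 \<and> u \<bullet> (A *v u) = lambda1 A"
    and psd_lambda1_diff: "psd (mat (lambda1 A) - A)"
proof -
  have cont: "continuous_on (sphere 0 1) (\<lambda>u. u \<bullet> (A *v u))"
    by (intro continuous_intros linear_continuous_on matrix_vector_mul_bounded_linear)
  have ne: "sphere (0::real^'m) 1 \<noteq> {}"
    by (metis norm_axis_1 mem_sphere_0 empty_iff)
  obtain w where w: "norm w = 1" and max: "\<And>u. norm u = 1 \<Longrightarrow> u \<bullet> (A *v u) \<le> w \<bullet> (A *v w)"
    using continuous_attains_sup[OF compact_sphere ne cont] by auto
  define c where "c = w \<bullet> (A *v w)"
  define C where "C = mat c - A"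
  have form: "u \<bullet> (C *v u) = c * (u \<bullet> u) - u \<bullet> (A *v u)" for u
    by (simp add: C_def matrix_vector_mult_diff_rdistrib mat_vector_mult inner_diff_right)
  have C: "psd C"
    unfolding psd_def
  proof (intro conjI allI)
    show "symmetric_matrix C"
      unfolding C_def by (intro symmetric_matrix_diff symmetric_matrix_mat A)
    fix u
    show "0 \<le> u \<bullet> (C *v u)"
    proof (cases "u = 0")
      case False
      have "(u /\<^sub>R norm u) \<bullet> (A *v (u /\<^sub>R norm u)) \<le> c"
        unfolding c_def by (rule max) (use False in simp)
      then have "u \<bullet> (A *v u) \<le> c * (norm u)\<^sup>2"
        using False by (simp add: matrix_vector_mult_scaleR field_simps power2_eq_square)
      then show ?thesis by (simp add: form power2_norm_eq_inner)
    qed simp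
  qed
  have "w \<bullet> (C *v w) = 0"
    using w by (simp add: form c_def norm_eq_1)
  then have "C *v w = 0" by (rule psd_kernel[OF C])
  then have "A *v w = c *\<^sub>R w"
    by (simp add: C_def matrix_vector_mult_diff_rdistrib mat_vector_mult)
  then have eig: "eigenvalue A c"
    unfolding eigenvalue_def using w by (intro exI[of _ w]) auto
  have "b \<le> c" if b: "eigenvalue A b" for b
  proof -
    obtain u where u: "u \<noteq> 0" "A *v u = b *\<^sub>R u" using b unfolding eigenvalue_def by blast
    have "0 \<le> u \<bullet> (C *v u)" using C by (auto simp: psd_def)
    then have "0 \<le> (c - b) * (u \<bullet> u)" by (simp add: form u algebra_simps)
    moreover have "0 < u \<bullet> u" using u(1) by simp
    ultimately show ?thesis by (smt (verit) mult_neg_pos)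
  qed
  with eig have "lambda1 A = c"
    unfolding lambda1_def by (intro Greatest_equality) auto
  with C w show "\<exists>u. norm u = 1 \<and> u \<bullet> (A *v u) = lambda1 A" "psd (mat (lambda1 A) - A)"
    by (auto simp: C_def c_def)
qed

lemma quadratic_form_le_lambda1:
  assumes "symmetric_matrix A" "norm u = 1"
  shows "u \<bullet> (A *v u) \<le> lambda1 A"
proof -
  have "0 \<le> u \<bullet> ((mat (lambda1 A) - A) *v u)"
    using psd_lambda1_diff[OF assms(1)] by (auto simp: psd_def)
  then show ?thesis
    using assms(2) by (simp add: matrix_vector_mult_diff_rdistrib mat_vector_mult inner_diff_right norm_eq_1)
qed

lemma loewner_le_mat_iff:
  assumes "symmetric_matrix A"
  shows "A \<preceq>\<^sub>L mat t \<longleftrightarrow> lambda1 A \<le> t"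
proof
  assume "A \<preceq>\<^sub>L mat t"
  moreover obtain u where "norm u = 1" "u \<bullet> (A *v u) = lambda1 A"
    using lambda1_attained[OF assms] by blast
  ultimately show "lambda1 A \<le> t"
    unfolding loewner_le_def psd_def
    by (metis diff_ge_0_iff_ge inner_diff_right inner_scaleR_right mat_vector_mult
        matrix_vector_mult_diff_rdistrib mult.right_neutral norm_eq_1)
next
  assume le: "lambda1 A \<le> t"
  show "A \<preceq>\<^sub>L mat t"
    unfolding loewner_le_def psd_def
  proof (intro conjI allI)
    show "symmetric_matrix (mat t - A)"
      by (intro symmetric_matrix_diff symmetric_matrix_mat assms)
    fix u
    have "0 \<le> u \<bullet> ((mat (lambda1 A) - A) *v u)"
      using psd_lambda1_diff[OF assms] by (auto simp: psd_def)
    then have "u \<bullet> (A *v u) \<le> lambda1 A * (u \<bullet> u)"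
      by (simp add: matrix_vector_mult_diff_rdistrib mat_vector_mult inner_diff_right)
    also have "\<dots> \<le> t * (u \<bullet> u)"
      by (intro mult_right_mono le) simp
    finally show "0 \<le> u \<bullet> ((mat t - A) *v u)"
      by (simp add: matrix_vector_mult_diff_rdistrib mat_vector_mult inner_diff_right)
  qed
qed

lemma loewner_le_mat_symmetric: "A \<preceq>\<^sub>L mat t \<Longrightarrow> symmetric_matrix A"
  using symmetric_matrix_diff[OF symmetric_matrix_mat, of "mat t - A" t]
  by (simp add: loewner_le_def psd_def)

lemma lambda1_convex:
  assumes "symmetric_matrix A" "symmetric_matrix B" "0 \<le> a" "0 \<le> b"
  shows "lambda1 (a *\<^sub>R A + b *\<^sub>R B) \<le> a * lambda1 A + b * lambda1 B"
proof -
  have "symmetric_matrix (a *\<^sub>R A + b *\<^sub>R B)"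
    by (intro symmetric_matrix_add symmetric_matrix_scaleR assms)
  then obtain u where u: "norm u = 1" "u \<bullet> ((a *\<^sub>R A + b *\<^sub>R B) *v u) = lambda1 (a *\<^sub>R A + b *\<^sub>R B)"
    using lambda1_attained by blast
  have "u \<bullet> ((a *\<^sub>R A + b *\<^sub>R B) *v u) = a * (u \<bullet> (A *v u)) + b * (u \<bullet> (B *v u))"
    by (simp add: matrix_vector_mult_add_rdistrib scaleR_matrix_vector_assoc[symmetric] inner_add_right)
  also have "\<dots> \<le> a * lambda1 A + b * lambda1 B"
    by (intro add_mono mult_left_mono quadratic_form_le_lambda1 assms u)
  finally show ?thesis using u by simp
qed

lemma norm_matrix_vector_mult_le: "norm (A *v u) \<le> norm (A :: real^'n^'m) * norm u"
proof -
  have "norm (A *v u) = L2_set (\<lambda>i. \<bar>A $ i \<bullet> u\<bar>) UNIV"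
    by (simp add: norm_vec_def matrix_vector_mul_component)
  also have "\<dots> \<le> L2_set (\<lambda>i. norm (A $ i) * norm u) UNIV"
    by (intro L2_set_mono Cauchy_Schwarz_ineq2) auto
  also have "\<dots> = norm A * norm u"
    by (simp add: norm_vec_def[of A] L2_set_left_distrib)
  finally show ?thesis .
qed

lemma lambda1_Lipschitz:
  assumes "symmetric_matrix A" "symmetric_matrix B"
  shows "lambda1 A \<le> lambda1 B + norm (A - B)"
proof -
  obtain u where u: "norm u = 1" "u \<bullet> (A *v u) = lambda1 A"
    using lambda1_attained[OF assms(1)] by blast
  have "u \<bullet> (A *v u) = u \<bullet> (B *v u) + u \<bullet> ((A - B) *v u)"
    by (simp add: matrix_vector_mult_diff_rdistrib inner_diff_right)
  also have "u \<bullet> ((A - B) *v u) \<le> norm u * norm ((A - B) *v u)"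
    by (rule norm_cauchy_schwarz)
  also have "\<dots> \<le> norm (A - B)"
    using norm_matrix_vector_mult_le[of "A - B" u] u by simp
  finally show ?thesis
    using quadratic_form_le_lambda1[OF assms(2) u(1)] u by simp
qed

lemma tendsto_lambda1:
  assumes "\<And>k. symmetric_matrix (A k)" "symmetric_matrix a" "(A \<longlongrightarrow> a) F"
  shows "((\<lambda>k. lambda1 (A k)) \<longlongrightarrow> lambda1 a) F"
proof (rule Lim_null_comparison[THEN LIM_zero_cancel])
  show "\<forall>\<^sub>F k in F. norm (lambda1 (A k) - lambda1 a) \<le> norm (A k - a)"
    using lambda1_Lipschitz[OF assms(1,2)] lambda1_Lipschitz[OF assms(2,1)]
    by (intro always_eventually allI) (smt (verit) norm_minus_commute real_norm_def)
  show "((\<lambda>k. norm (A k - a)) \<longlongrightarrow> 0) F"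
    using assms(3) by (simp add: LIM_zero tendsto_norm_zero)
qed

section \<open>Derivatives of twice continuously differentiable maps\<close>

lemma C2_has_derivative:
  assumes "C2 F"
  shows "(F has_derivative frechet_derivative F (at x)) (at x)"
  using assms unfolding C2_def by (metis differentiableI frechet_derivative_works)

lemma C2_continuous_on: "C2 F \<Longrightarrow> continuous_on S F"
  using C2_has_derivative[of F] has_derivative_continuous continuous_at_imp_continuous_on by blast

lemma C2_tendsto: "C2 F \<Longrightarrow> (X \<longlongrightarrow> x) A \<Longrightarrow> ((\<lambda>k. F (X k)) \<longlongrightarrow> F x) A"
  using C2_has_derivative[of F x] has_derivative_continuous isCont_tendsto_compose by blast

lemma C2_linear: "C2 F \<Longrightarrow> linear (frechet_derivative F (at x))"
  using C2_has_derivative has_derivative_linear by blast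

lemma C2_tendsto_partial_deriv:
  assumes "C2 F" "(X \<longlongrightarrow> x) A"
  shows "((\<lambda>k. partial_deriv F i (X k)) \<longlongrightarrow> partial_deriv F i x) A"
proof -
  obtain F' F'' where F': "\<And>x. (F has_derivative blinfun_apply (F' x)) (at x)"
    and F'': "\<And>x. (F' has_derivative blinfun_apply (F'' x)) (at x)"
    using assms(1) unfolding C2_def by blast
  have "frechet_derivative F (at y) = blinfun_apply (F' y)" for y
    using F' frechet_derivative_at by metis
  then have eq: "partial_deriv F i y = blinfun_apply (F' y) (axis i 1)" for y
    by (simp add: partial_deriv_def)
  have "((\<lambda>k. F' (X k)) \<longlongrightarrow> F' x) A"
    using F'' has_derivative_continuous isCont_tendsto_compose assms(2) by blast
  then show ?thesis
    unfolding eq by (intro tendsto_intros)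
qed

text \<open>The second derivative is bounded on \<open>K\<close>, hence the first derivative is Lipschitz there, and the
mean value inequality turns this into a quadratic remainder.\<close>

lemma C2_linearization_error:
  fixes F :: "'a::euclidean_space \<Rightarrow> 'b::real_normed_vector"
  assumes "C2 F" "compact K" "convex K"
  obtains L where "0 \<le> L"
    "\<And>x d. x \<in> K \<Longrightarrow> x + d \<in> K \<Longrightarrow> norm (F (x + d) - F x - frechet_derivative F (at x) d) \<le> L * (norm d)\<^sup>2"
proof -
  obtain F' F'' where F': "\<And>x. (F has_derivative blinfun_apply (F' x)) (at x)"
    and F'': "\<And>x. (F' has_derivative blinfun_apply (F'' x)) (at x)" and cont: "continuous_on UNIV F''"
    using assms(1) unfolding C2_def by blast
  have "compact (F'' ` K)"
    using assms(2) cont by (intro compact_continuous_image) (auto intro: continuous_on_subset)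
  then have "bounded (F'' ` K)" by (rule compact_imp_bounded)
  then obtain L where L: "0 < L" "\<And>x. x \<in> K \<Longrightarrow> norm (F'' x) \<le> L"
    unfolding bounded_pos by (metis imageI)
  have Lip: "norm (F' x - F' y) \<le> L * norm (x - y)" if "x \<in> K" "y \<in> K" for x y
    using that assms(3) L F''
    by (intro differentiable_bound[where f' = "\<lambda>x. blinfun_apply (F'' x)" and S = K])
      (auto simp: norm_blinfun.rep_eq[symmetric] intro: has_derivative_at_withinI)
  show ?thesis
  proof
    show "0 \<le> L" using L by simp
    fix x d assume x: "x \<in> K" "x + d \<in> K"
    have seg: "closed_segment x (x + d) \<subseteq> K"
      using x assms(3) by (simp add: closed_segment_subset)
    have "norm (F (x + d) - F x - blinfun_apply (F' x) (x + d - x)) \<le> norm (x + d - x) * (L * norm d)"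
    proof (rule differentiable_bound_linearization[where S = "closed_segment x (x + d)" and f' = "\<lambda>z. blinfun_apply (F' z)"])
      show "x + t *\<^sub>R (x + d - x) \<in> closed_segment x (x + d)" if "t \<in> {0..1}" for t
        using that by (auto simp: closed_segment_def intro!: exI[of _ t] simp: algebra_simps)
      show "onorm (blinfun_apply (F' z) - blinfun_apply (F' x)) \<le> L * norm d"
        if z: "z \<in> closed_segment x (x + d)" for z
      proof -
        have "blinfun_apply (F' z) - blinfun_apply (F' x) = blinfun_apply (F' z - F' x)"
          by (simp add: fun_eq_iff blinfun.diff_left)
        then have "onorm (blinfun_apply (F' z) - blinfun_apply (F' x)) = norm (F' z - F' x)"
          by (simp add: norm_blinfun.rep_eq)
        also have "\<dots> \<le> L * norm (z - x)"
          using Lip seg z x by blast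
        also have "\<dots> \<le> L * norm d"
          using segment_bound1[OF z] L by (intro mult_left_mono) auto
        finally show ?thesis .
      qed
    qed (auto intro: has_derivative_at_withinI F')
    moreover have "frechet_derivative F (at x) = blinfun_apply (F' x)"
      using F' frechet_derivative_at by metis
    ultimately show "norm (F (x + d) - F x - frechet_derivative F (at x) d) \<le> L * (norm d)\<^sup>2"
      by (simp add: power2_eq_square mult_ac)
  qed
qed

lemma C2_derivative_bounded:
  fixes F :: "'a::real_normed_vector \<Rightarrow> 'b::real_normed_vector"
  assumes "C2 F" "compact K"
  obtains M where "0 \<le> M" "\<And>x d. x \<in> K \<Longrightarrow> norm (frechet_derivative F (at x) d) \<le> M * norm d"
proof -
  obtain F' F'' where F': "\<And>x. (F has_derivative blinfun_apply (F' x)) (at x)"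
    and F'': "\<And>x. (F' has_derivative blinfun_apply (F'' x)) (at x)"
    using assms(1) unfolding C2_def by blast
  have "continuous_on K F'"
    using F'' has_derivative_continuous continuous_at_imp_continuous_on by blast
  then have "bounded (F' ` K)"
    using assms(2) by (intro compact_imp_bounded compact_continuous_image)
  then obtain M where M: "0 < M" "\<And>x. x \<in> K \<Longrightarrow> norm (F' x) \<le> M"
    unfolding bounded_pos by (metis imageI)
  show ?thesis
  proof
    show "0 \<le> M" using M(1) by simp
    fix x d assume x: "x \<in> K"
    have "frechet_derivative F (at x) = blinfun_apply (F' x)"
      using F' frechet_derivative_at by metis
    then have "norm (frechet_derivative F (at x) d) \<le> norm (F' x) * norm d"
      by (simp add: norm_blinfun)
    also have "\<dots> \<le> M * norm d"
      by (intro mult_right_mono M(2) x) simp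
    finally show "norm (frechet_derivative F (at x) d) \<le> M * norm d" .
  qed
qed

lemma tendsto_0_if_norm_square_le:
  fixes u :: "nat \<Rightarrow> 'a::real_normed_vector"
  assumes c: "0 < c" and le: "\<And>k. c * (norm (u k))\<^sup>2 \<le> g k" and g: "g \<longlonglongrightarrow> 0"
  shows "u \<longlonglongrightarrow> 0"
proof -
  have "(\<lambda>k. (norm (u k))\<^sup>2) \<longlonglongrightarrow> 0"
  proof (rule Lim_null_comparison)
    show "(\<lambda>k. g k / c) \<longlonglongrightarrow> 0"
      using tendsto_divide[OF g tendsto_const, of c] c by simp
    show "\<forall>\<^sub>F k in sequentially. norm ((norm (u k))\<^sup>2) \<le> g k / c"
    proof (intro always_eventually allI)
      show "norm ((norm (u k))\<^sup>2) \<le> g k / c" for k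
        using le[of k] c by (simp add: field_simps)
    qed
  qed
  then have "(\<lambda>k. norm (u k)) \<longlonglongrightarrow> 0"
    by (simp add: power_tendsto_0_iff)
  then show ?thesis by (simp add: tendsto_norm_zero_iff)
qed

lemma linear_axis_expansion:
  assumes "linear T"
  shows "(\<Sum>i\<in>UNIV. (d $ i) *\<^sub>R T (axis i 1)) = T (d :: real^'n)"
proof -
  have "T d = T (\<Sum>i\<in>UNIV. (d $ i) *\<^sub>R axis i 1)"
    using basis_expansion[of d] by (simp add: scalar_mult_eq_scaleR)
  also have "\<dots> = (\<Sum>i\<in>UNIV. (d $ i) *\<^sub>R T (axis i 1))"
    by (simp add: linear_sum[OF assms] linear_cmul[OF assms])
  finally show ?thesis by simp
qed

lemma DG_eq_frechet: "C2 G \<Longrightarrow> DG G x d = frechet_derivative G (at x) d"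
  unfolding DG_def partial_deriv_def by (rule linear_axis_expansion[OF C2_linear])

lemma grad_inner_eq_frechet: "C2 f \<Longrightarrow> grad f x \<bullet> d = frechet_derivative f (at x) d"
  using linear_axis_expansion[OF C2_linear[of f x], of d]
  by (simp add: grad_def partial_deriv_def inner_vec_def mult.commute)

lemma Jac_mult_eq_frechet: "C2 h \<Longrightarrow> Jac h x *v d = frechet_derivative h (at x) d"
  unfolding jacobian_def using C2_linear by (intro matrix_works) (simp add: linear_matrix_vector_mul_eq)

lemma DG_linear: "linear (DG G x)"
  unfolding DG_def by (intro linearI) (simp_all add: algebra_simps sum.distrib scaleR_sum_right)

text \<open>Transposition is linear and fixes \<open>G\<close>, so it fixes the derivative of \<open>G\<close>.\<close>

lemma DG_symmetric:
  assumes "C2 G" "\<And>x. symmetric_matrix (G x)"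
  shows "symmetric_matrix (DG G x d)"
proof -
  let ?D = "frechet_derivative G (at x)"
  have "linear (transpose :: real^'m^'m \<Rightarrow> real^'m^'m)"
    by (intro linearI) (simp_all add: transpose_def vec_eq_iff)
  then have "((\<lambda>x. transpose (G x)) has_derivative (\<lambda>d. transpose (?D d))) (at x)"
    using C2_has_derivative[OF assms(1), of x] linear_conv_bounded_linear bounded_linear.has_derivative by blast
  moreover have "(\<lambda>x. transpose (G x)) = G"
    using assms(2) by (auto simp: symmetric_matrix_def)
  ultimately have "(\<lambda>d. transpose (?D d)) = ?D"
    using C2_has_derivative[OF assms(1), of x] has_derivative_unique by metis
  then show ?thesis
    by (auto simp: symmetric_matrix_def DG_eq_frechet[OF assms(1)] dest: fun_cong)
qed

lemma mat_inner_DG: "mat_inner Y (DG G x d) = DG_adj G x Y \<bullet> d"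
  by (simp add: DG_def DG_adj_def mat_inner_sum mat_inner_bilinear inner_vec_def mat_inner_commute[of Y] mult.commute)

lemma DG_adj_scaleR: "DG_adj G x (c *\<^sub>R Y) = c *\<^sub>R DG_adj G x Y"
  by (simp add: DG_adj_def vec_eq_iff mat_inner_bilinear)

lemma tendsto_grad: "C2 f \<Longrightarrow> (X \<longlongrightarrow> x) A \<Longrightarrow> ((\<lambda>k. grad f (X k)) \<longlongrightarrow> grad f x) A"
  unfolding grad_def by (intro tendsto_intros C2_tendsto_partial_deriv)

lemma tendsto_Jac:
  assumes "C2 h" "(X \<longlongrightarrow> x) A"
  shows "((\<lambda>k. Jac h (X k)) \<longlongrightarrow> Jac h x) A"
proof -
  have "Jac h y = (\<chi> i j. partial_deriv h j y $ i)" for y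
    by (simp add: jacobian_def matrix_def partial_deriv_def)
  then show ?thesis
    by (simp only:) (intro tendsto_intros C2_tendsto_partial_deriv assms)
qed

lemma tendsto_DG:
  assumes "C2 G" "(X \<longlongrightarrow> x) A" "(d \<longlongrightarrow> e) A"
  shows "((\<lambda>k. DG G (X k) (d k)) \<longlongrightarrow> DG G x e) A"
  unfolding DG_def using assms by (intro tendsto_intros C2_tendsto_partial_deriv)

lemma tendsto_DG_adj:
  assumes "C2 G" "(X \<longlongrightarrow> x) A" "(Y \<longlongrightarrow> y) A"
  shows "((\<lambda>k. DG_adj G (X k) (Y k)) \<longlongrightarrow> DG_adj G x y) A"
  unfolding DG_adj_def using assms by (intro tendsto_intros C2_tendsto_partial_deriv)

section \<open>The exact penalty and its linearization\<close>

lemma norm1_triangle: "norm1 (y + z) \<le> norm1 y + norm1 z"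
  unfolding norm1_def by (simp add: sum.distrib[symmetric] sum_mono abs_triangle_ineq)

lemma norm1_scaleR: "norm1 (a *\<^sub>R y) = \<bar>a\<bar> * norm1 y"
  by (simp add: norm1_def abs_mult sum_distrib_left)

lemma norm1_nonneg: "0 \<le> norm1 y"
  by (simp add: norm1_def sum_nonneg)

lemma norm1_le_norm: "norm1 (y :: real^'l) \<le> real CARD('l) * norm y"
proof -
  have "norm1 y \<le> (\<Sum>i\<in>(UNIV::'l set). norm y)"
    unfolding norm1_def by (intro sum_mono component_le_norm_cart)
  then show ?thesis by simp
qed

lemma tendsto_norm1 [tendsto_intros]:
  fixes y :: "_ \<Rightarrow> real^'l"
  assumes "(y \<longlongrightarrow> z) A"
  shows "((\<lambda>k. norm1 (y k)) \<longlongrightarrow> norm1 z) A"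
  unfolding norm1_def using assms by (intro tendsto_intros)

lemma one_inner: "1 \<bullet> (y :: real^'l) = (\<Sum>i\<in>UNIV. y $ i)"
  by (simp add: inner_vec_def)

lemma norm1_diff_le:
  fixes r s :: "real^'l"
  assumes "0 \<le> r" "0 \<le> s"
  shows "norm1 (r - s) \<le> 1 \<bullet> (r + s)"
  unfolding norm1_def one_inner
proof (rule sum_mono)
  show "\<bar>(r - s) $ i\<bar> \<le> (r + s) $ i" for i
    using assms[unfolded less_eq_vec_def, rule_format, of i] by simp
qed

lemma violation_nonneg: "0 \<le> violation h G x"
  by (simp add: violation_def norm1_nonneg add_nonneg_nonneg)

lemma tendsto_violation:
  assumes "C2 h" "C2 G" "\<And>x. symmetric_matrix (G x)" "(X \<longlongrightarrow> x) A"
  shows "((\<lambda>k. violation h G (X k)) \<longlongrightarrow> violation h G x) A"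
  unfolding violation_def
  by (intro tendsto_add tendsto_norm1 tendsto_max tendsto_const tendsto_lambda1
      C2_tendsto[OF assms(1)] C2_tendsto[OF assms(2)] assms(3,4))

text \<open>Both the 1-norm and the positive part of the largest eigenvalue are convex, and the linearized
constraints at \<open>a d\<close> are the convex combination of those at \<open>0\<close> and \<open>d\<close>.\<close>

lemma lin_viol_convex:
  assumes "C2 G" "\<And>x. symmetric_matrix (G x)" "0 \<le> a" "a \<le> 1"
  shows "lin_viol h G x (a *\<^sub>R d) \<le> lin_viol h G x 0 - a * lin_viol_red h G x d"
proof -
  let ?h = "\<lambda>d. h x + Jac h x *v d" and ?G = "\<lambda>d. G x + DG G x d"
  have sym: "symmetric_matrix (?G d)" for d
    by (intro symmetric_matrix_add DG_symmetric assms)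
  have "?h (a *\<^sub>R d) = (1 - a) *\<^sub>R ?h 0 + a *\<^sub>R ?h d"
    by (simp add: matrix_vector_mult_scaleR algebra_simps)
  then have "norm1 (?h (a *\<^sub>R d)) \<le> (1 - a) * norm1 (?h 0) + a * norm1 (?h d)"
    using norm1_triangle[of "(1 - a) *\<^sub>R ?h 0" "a *\<^sub>R ?h d"] assms(3,4) by (simp add: norm1_scaleR)
  moreover have "?G (a *\<^sub>R d) = (1 - a) *\<^sub>R ?G 0 + a *\<^sub>R ?G d"
    by (simp add: linear_0[OF DG_linear] linear_cmul[OF DG_linear] algebra_simps)
  then have "lambda1 (?G (a *\<^sub>R d)) \<le> (1 - a) * lambda1 (?G 0) + a * lambda1 (?G d)"
    using lambda1_convex[OF sym sym, of "1 - a" a] assms(3,4) by simp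
  then have "max 0 (lambda1 (?G (a *\<^sub>R d))) \<le> (1 - a) * max 0 (lambda1 (?G 0)) + a * max 0 (lambda1 (?G d))"
    using assms(3,4) mult_left_mono[of "lambda1 (?G 0)" "max 0 (lambda1 (?G 0))" "1 - a"]
      mult_left_mono[of "lambda1 (?G d)" "max 0 (lambda1 (?G d))" a]
    by (intro max.boundedI) (auto intro!: add_nonneg_nonneg mult_nonneg_nonneg)
  ultimately show ?thesis
    by (simp add: lin_viol_def lin_viol_red_def algebra_simps)
qed

lemma lin_viol_0: "lin_viol h G x 0 = violation h G x"
  by (simp add: lin_viol_def violation_def linear_0[OF DG_linear])

lemma violation_le_lin_viol:
  fixes h :: "real^'n \<Rightarrow> real^'l"
  assumes "C2 G" "\<And>x. symmetric_matrix (G x)"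
  shows "violation h G (x + d) \<le> lin_viol h G x d
      + real CARD('l) * norm (h (x + d) - h x - Jac h x *v d) + norm (G (x + d) - G x - DG G x d)"
proof -
  have "norm1 (h (x + d)) \<le> norm1 (h x + Jac h x *v d) + norm1 (h (x + d) - h x - Jac h x *v d)"
    using norm1_triangle[of "h x + Jac h x *v d" "h (x + d) - h x - Jac h x *v d"] by simp
  also have "norm1 (h (x + d) - h x - Jac h x *v d) \<le> real CARD('l) * norm (h (x + d) - h x - Jac h x *v d)"
    by (rule norm1_le_norm)
  finally have "norm1 (h (x + d)) \<le> norm1 (h x + Jac h x *v d) + real CARD('l) * norm (h (x + d) - h x - Jac h x *v d)"
    by simp
  moreover have "symmetric_matrix (G x + DG G x d)"
    by (intro symmetric_matrix_add DG_symmetric assms)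
  then have "lambda1 (G (x + d)) \<le> lambda1 (G x + DG G x d) + norm (G (x + d) - G x - DG G x d)"
    using lambda1_Lipschitz[OF assms(2), of "G x + DG G x d" "x + d"] by (simp add: algebra_simps)
  ultimately show ?thesis
    unfolding violation_def lin_viol_def using norm_ge_zero[of "G (x + d) - G x - DG G x d"] by argo
qed

text \<open>The line search rests on this estimate: along \<open>d\<close> the penalty function decreases at least at the
rate predicted by the linearized model, up to a quadratic error that is uniform on a compact convex
set. Replacing each function by its linearization costs a quadratic remainder, since the penalty is
Lipschitz in the constraint values; the model itself is convex.\<close>

lemma penalty_model_decrease:
  fixes f :: "real^'n \<Rightarrow> real" and h :: "real^'n \<Rightarrow> real^'l" and G :: "real^'n \<Rightarrow> real^'m^'m"
  assumes C2: "C2 f" "C2 h" "C2 G" and sym: "\<And>x. symmetric_matrix (G x)"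
    and K: "compact K" "convex K" and "0 \<le> \<rho>"
  obtains C where "0 \<le> C"
    "\<And>x d a. x \<in> K \<Longrightarrow> x + d \<in> K \<Longrightarrow> 0 \<le> a \<Longrightarrow> a \<le> 1 \<Longrightarrow>
      penalty f h G \<rho> (x + a *\<^sub>R d) - penalty f h G \<rho> x \<le> - a * lin_pen_red f h G x \<rho> d + C * (a * norm d)\<^sup>2"
proof -
  obtain Lf where Lf: "0 \<le> Lf" "\<And>x d. x \<in> K \<Longrightarrow> x + d \<in> K \<Longrightarrow> norm (f (x + d) - f x - grad f x \<bullet> d) \<le> Lf * (norm d)\<^sup>2"
    using C2_linearization_error[OF C2(1) K] unfolding grad_inner_eq_frechet[OF C2(1), symmetric] by blast
  obtain Lh where Lh: "0 \<le> Lh" "\<And>x d. x \<in> K \<Longrightarrow> x + d \<in> K \<Longrightarrow> norm (h (x + d) - h x - Jac h x *v d) \<le> Lh * (norm d)\<^sup>2"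
    using C2_linearization_error[OF C2(2) K] unfolding Jac_mult_eq_frechet[OF C2(2), symmetric] by blast
  obtain LG where LG: "0 \<le> LG" "\<And>x d. x \<in> K \<Longrightarrow> x + d \<in> K \<Longrightarrow> norm (G (x + d) - G x - DG G x d) \<le> LG * (norm d)\<^sup>2"
    using C2_linearization_error[OF C2(3) K] unfolding DG_eq_frechet[OF C2(3), symmetric] by blast
  let ?C = "\<rho> * Lf + real CARD('l) * Lh + LG"
  show ?thesis
  proof
    show "0 \<le> ?C" using Lf(1) Lh(1) LG(1) \<open>0 \<le> \<rho>\<close> by simp
    fix x d and a :: real
    assume x: "x \<in> K" "x + d \<in> K" and a: "0 \<le> a" "a \<le> 1"
    let ?q = "(a * norm d)\<^sup>2"
    have q: "(norm (a *\<^sub>R d))\<^sup>2 = ?q" using a by simp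
    have xa: "x + a *\<^sub>R d \<in> K"
    proof -
      have "x + a *\<^sub>R d = (1 - a) *\<^sub>R x + a *\<^sub>R (x + d)" by (simp add: algebra_simps)
      then show ?thesis using convexD[OF K(2) x, of "1 - a" a] a by simp
    qed
    have "f (x + a *\<^sub>R d) - f x \<le> a * (grad f x \<bullet> d) + Lf * ?q"
      using Lf(2)[OF x(1) xa] unfolding q by (simp add: abs_le_iff)
    then have "\<rho> * f (x + a *\<^sub>R d) - \<rho> * f x \<le> \<rho> * (a * (grad f x \<bullet> d) + Lf * ?q)"
      using \<open>0 \<le> \<rho>\<close> by (metis mult_left_mono right_diff_distrib)
    moreover have "real CARD('l) * norm (h (x + a *\<^sub>R d) - h x - Jac h x *v (a *\<^sub>R d)) \<le> real CARD('l) * (Lh * ?q)"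
      using Lh(2)[OF x(1) xa] unfolding q by (intro mult_left_mono) auto
    moreover have "norm (G (x + a *\<^sub>R d) - G x - DG G x (a *\<^sub>R d)) \<le> LG * ?q"
      using LG(2)[OF x(1) xa] unfolding q .
    ultimately have "violation h G (x + a *\<^sub>R d) \<le> lin_viol h G x (a *\<^sub>R d) + real CARD('l) * (Lh * ?q) + LG * ?q"
      using violation_le_lin_viol[OF C2(3) sym, of h x "a *\<^sub>R d"] by linarith
    moreover note \<open>\<rho> * f (x + a *\<^sub>R d) - \<rho> * f x \<le> _\<close>
      lin_viol_convex[OF C2(3) sym a, of h x d] lin_viol_0[of h G x]
    ultimately show "penalty f h G \<rho> (x + a *\<^sub>R d) - penalty f h G \<rho> x \<le> - a * lin_pen_red f h G x \<rho> d + ?C * ?q"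
      unfolding penalty_def lin_pen_red_def by (simp add: algebra_simps)
  qed
qed

section \<open>The two subproblems\<close>

lemma pos_part_nonneg: "0 \<le> pos_part y"
  and neg_part_nonpos: "neg_part y \<le> 0"
  and pos_part_plus_neg_part: "pos_part y + neg_part y = y"
  by (auto simp: pos_part_def neg_part_def less_eq_vec_def vec_eq_iff)

lemma norm1_eq_parts: "norm1 y = 1 \<bullet> (pos_part y + - neg_part y)"
  unfolding norm1_def one_inner by (intro sum.cong) (auto simp: pos_part_def neg_part_def)

lemma fea_feasible_least_shift:
  assumes "symmetric_matrix (G x + DG G x d)"
  shows "fea_feasible h G x d (pos_part (h x + Jac h x *v d)) (- neg_part (h x + Jac h x *v d))
    (max 0 (lambda1 (G x + DG G x d)))"
  using pos_part_nonneg[of "h x + Jac h x *v d"] neg_part_nonpos[of "h x + Jac h x *v d"]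
    pos_part_plus_neg_part[of "h x + Jac h x *v d"]
  by (simp add: fea_feasible_def loewner_le_mat_iff[OF assms])

lemma fea_feasible_t_ge:
  assumes "fea_feasible h G x d r s t"
  shows "max 0 (lambda1 (G x + DG G x d)) \<le> t"
  using assms loewner_le_mat_iff[OF loewner_le_mat_symmetric] by (auto simp: fea_feasible_def)

text \<open>At a solution \<open>t\<close> cannot be lowered, and the only lower bounds for \<open>t\<close> are \<open>0\<close> and the largest
eigenvalue of the linearized matrix constraint.\<close>

lemma fea_solution_t:
  assumes "fea_solution h G x B d r s t"
  shows "t = max 0 (lambda1 (G x + DG G x d))"
proof (rule antisym)
  let ?t = "max 0 (lambda1 (G x + DG G x d))"
  have feas: "fea_feasible h G x d r s t"
    using assms by (simp add: fea_solution_def)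
  then have "symmetric_matrix (G x + DG G x d)"
    using loewner_le_mat_symmetric by (auto simp: fea_feasible_def)
  then have "fea_feasible h G x d r s ?t"
    using feas by (simp add: fea_feasible_def loewner_le_mat_iff)
  then have "fea_obj B d r s t \<le> fea_obj B d r s ?t"
    using assms by (auto simp: fea_solution_def)
  then show "t \<le> ?t" by (simp add: fea_obj_def)
  show "?t \<le> t" using feas by (rule fea_feasible_t_ge)
qed

text \<open>The step of the second subproblem inherits the linear infeasibility reduction of the first one.
Comparing the solution of the first subproblem with the zero step and its least shift gives
\<open>1 \<bullet> (r + s) + t + 1/2 (e \<bullet> B e) \<le> v(x)\<close>, and every step \<open>d\<close> meeting the shifted constraints has
linearized violation at most \<open>1 \<bullet> (r + s) + t\<close>.\<close>

lemma fea_solution_lin_viol_red: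
  assumes sol: "fea_solution h G x B e r s t" and d: "opt_feasible h G x r s t d"
    and sym: "symmetric_matrix (G x)"
  shows "1/2 * (e \<bullet> (B *v e)) \<le> lin_viol_red h G x d"
proof -
  have feas: "fea_feasible h G x e r s t"
    using sol by (simp add: fea_solution_def)
  have "symmetric_matrix (G x + DG G x 0)"
    using sym by (simp add: linear_0[OF DG_linear])
  from fea_feasible_least_shift[OF this, of h] sol
  have "fea_obj B e r s t \<le> lin_viol h G x 0"
    unfolding fea_solution_def fea_obj_def lin_viol_def norm1_eq_parts by fastforce
  moreover have "fea_feasible h G x d r s t"
    using d feas by (simp add: fea_feasible_def opt_feasible_def)
  then have "lin_viol h G x d \<le> 1 \<bullet> (r + s) + t"
    unfolding lin_viol_def using norm1_diff_le[of r s] fea_feasible_t_ge[of h G x d r s t]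
    by (auto simp: fea_feasible_def)
  ultimately show ?thesis
    by (simp add: lin_viol_red_def fea_obj_def)
qed

text \<open>The Lagrangian is quadratic, so its gradient can be read off as the coefficient of \<open>c\<close> in its
restriction to a line.\<close>

lemma fea_lagrangian_line:
  assumes "symmetric_matrix B"
  shows "fea_lagrangian h G x B \<mu> Y \<nu>r \<nu>s \<nu>t (d + c *\<^sub>R d') (r + c *\<^sub>R r') (s + c *\<^sub>R s') (t + c * t')
    = fea_lagrangian h G x B \<mu> Y \<nu>r \<nu>s \<nu>t d r s t
      + c * ((B *v d + transpose (Jac h x) *v \<mu> + DG_adj G x Y) \<bullet> d'
             + (1 - \<mu> - \<nu>r) \<bullet> r' + (1 + \<mu> - \<nu>s) \<bullet> s' + (1 - trace Y - \<nu>t) * t')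
      + c\<^sup>2 * (1/2 * (d' \<bullet> (B *v d')))"
proof -
  have J: "\<mu> \<bullet> (Jac h x *v w) = (transpose (Jac h x) *v \<mu>) \<bullet> w" for w
    by (simp add: dot_lmul_matrix)
  have B: "d \<bullet> (B *v d') = (B *v d) \<bullet> d'"
    using symmetric_matrix_inner[OF assms, of d d'] by (simp add: inner_commute)
  have m: "mat (t + c * t') = mat t + c *\<^sub>R mat t'"
    by (simp add: mat_def vec_eq_iff)
  show ?thesis
    unfolding fea_lagrangian_def fea_obj_def quadratic_form_add[OF assms] B m
    by (simp add: matrix_vector_right_distrib matrix_vector_mult_scaleR linear_add[OF DG_linear] linear_cmul[OF DG_linear]
        mat_inner_bilinear mat_inner_DG mat_inner_mat inner_add_left inner_add_right inner_diff_left inner_diff_right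
        J algebra_simps del: transpose_matrix_vector)
qed

text \<open>The multipliers of the sign constraints are eliminated: stationarity of the Lagrangian in \<open>r\<close>, \<open>s\<close> and
\<open>t\<close> makes them \<open>1 - \<mu>\<close>, \<open>1 + \<mu>\<close> and \<open>1 - trace Y\<close>, so their signs and complementarity are the conditions
on \<open>\<mu>\<close> and \<open>Y\<close> in the definition of an infeasible stationary point.\<close>

lemma fea_multipliers_KKT:
  fixes d :: "real^'n" and \<mu> r s :: "real^'l" and Y :: "real^'m^'m"
  assumes mult: "fea_multipliers h G x B d r s t \<mu> Y" and B: "symmetric_matrix B"
  shows "B *v d + transpose (Jac h x) *v \<mu> + DG_adj G x Y = 0"
    and "- 1 \<le> \<mu>" "\<mu> \<le> 1" "trace Y \<le> 1"
    and "(1 - \<mu>) * r = 0" "(1 + \<mu>) * s = 0" "(1 - trace Y) * t = 0"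
proof -
  obtain \<nu>r \<nu>s \<nu>t where \<nu>: "0 \<le> \<nu>r" "0 \<le> \<nu>s" "0 \<le> \<nu>t" "\<nu>r * r = 0" "\<nu>s * s = 0" "\<nu>t * t = 0"
    and der: "((\<lambda>(d, r, s, t). fea_lagrangian h G x B \<mu> Y \<nu>r \<nu>s \<nu>t d r s t) has_derivative (\<lambda>_. 0)) (at (d, r, s, t))"
    using mult unfolding fea_multipliers_def by blast
  define g where "g = B *v d + transpose (Jac h x) *v \<mu> + DG_adj G x Y"
  have dir: "g \<bullet> d' + (1 - \<mu> - \<nu>r) \<bullet> r' + (1 + \<mu> - \<nu>s) \<bullet> s' + (1 - trace Y - \<nu>t) * t' = 0" for d' r' s' t'
  proof -
    let ?c = "g \<bullet> d' + (1 - \<mu> - \<nu>r) \<bullet> r' + (1 + \<mu> - \<nu>s) \<bullet> s' + (1 - trace Y - \<nu>t) * t'"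
    let ?z = "(d, r, s, t)" and ?z' = "(d', r', s', t')"
    let ?L = "\<lambda>(d, r, s, t). fea_lagrangian h G x B \<mu> Y \<nu>r \<nu>s \<nu>t d r s t"
    have "((\<lambda>c. ?L (?z + c *\<^sub>R ?z')) has_derivative (\<lambda>_. 0)) (at (0::real))"
    proof (rule has_derivative_compose[where g = ?L and g' = "\<lambda>_. 0" and f = "\<lambda>c. ?z + c *\<^sub>R ?z'" and f' = "\<lambda>c. c *\<^sub>R ?z'"])
      show "((\<lambda>c. ?z + c *\<^sub>R ?z') has_derivative (\<lambda>c. c *\<^sub>R ?z')) (at 0)"
        by (auto intro!: derivative_eq_intros)
      show "(?L has_derivative (\<lambda>_. 0)) (at (?z + 0 *\<^sub>R ?z'))"
        using der by simp
    qed
    moreover have "(\<lambda>c. ?L (?z + c *\<^sub>R ?z')) = (\<lambda>c. ?L ?z + c * ?c + c\<^sup>2 * (1/2 * (d' \<bullet> (B *v d'))))"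
      by (simp add: fun_eq_iff fea_lagrangian_line[OF B] g_def)
    ultimately have "((\<lambda>c. ?L ?z + c * ?c + c\<^sup>2 * (1/2 * (d' \<bullet> (B *v d')))) has_field_derivative 0) (at 0)"
      by (simp add: has_derivative_imp_has_field_derivative)
    moreover have "((\<lambda>c. ?L ?z + c * ?c + c\<^sup>2 * (1/2 * (d' \<bullet> (B *v d')))) has_field_derivative ?c) (at 0)"
      by (auto intro!: derivative_eq_intros)
    ultimately show ?thesis by (rule DERIV_unique[symmetric])
  qed
  have "g \<bullet> g = 0" using dir[of g 0 0 0] by simp
  then show "B *v d + transpose (Jac h x) *v \<mu> + DG_adj G x Y = 0" by (simp add: g_def)
  have "(1 - \<mu> - \<nu>r) \<bullet> (1 - \<mu> - \<nu>r) = 0" using dir[of 0 "1 - \<mu> - \<nu>r" 0 0] by simp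
  then have r: "\<nu>r = 1 - \<mu>" by simp
  have "(1 + \<mu> - \<nu>s) \<bullet> (1 + \<mu> - \<nu>s) = 0" using dir[of 0 0 "1 + \<mu> - \<nu>s" 0] by simp
  then have s: "\<nu>s = 1 + \<mu>" by simp
  have t: "\<nu>t = 1 - trace Y" using dir[of 0 0 0 1] by simp
  show "(1 - \<mu>) * r = 0" "(1 + \<mu>) * s = 0" "(1 - trace Y) * t = 0" "trace Y \<le> 1"
    using \<nu> by (simp_all add: r s t)
  show "- 1 \<le> \<mu>" "\<mu> \<le> 1"
    using \<nu>(1,2) unfolding r s less_eq_vec_def by (simp_all add: algebra_simps) (smt (verit))+
qed

text \<open>If \<open>y\<^sub>i > 0\<close> then \<open>r\<^sub>i > 0\<close>, so \<open>\<mu>\<^sub>i = 1\<close>; similarly for \<open>y\<^sub>i < 0\<close>. This puts complementarity in a form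
that mentions only \<open>y\<close>, so that it passes to the limit without convergence of \<open>r\<close> and \<open>s\<close>.\<close>

lemma complementarity_pos_part:
  fixes y r s \<mu> :: "real^'l"
  assumes y: "y = r - s" and nn: "0 \<le> r" "0 \<le> s" and compl: "(1 - \<mu>) * r = 0" "(1 + \<mu>) * s = 0"
  shows "(1 - \<mu>) * pos_part y = 0" "(1 + \<mu>) * neg_part y = 0"
proof -
  have "(1 - \<mu> $ i) * max 0 (y $ i) = 0 \<and> (1 + \<mu> $ i) * min 0 (y $ i) = 0" for i
  proof -
    have "(1 - \<mu> $ i) * r $ i = 0" "(1 + \<mu> $ i) * s $ i = 0" "0 \<le> r $ i" "0 \<le> s $ i" "y $ i = r $ i - s $ i"
      using nn y compl by (simp_all add: vec_eq_iff less_eq_vec_def)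
    then show ?thesis by (auto simp: max_def min_def)
  qed
  then show "(1 - \<mu>) * pos_part y = 0" "(1 + \<mu>) * neg_part y = 0"
    by (auto simp: vec_eq_iff pos_part_def neg_part_def)
qed

text \<open>The size of the optimality step \<open>d\<close> is controlled by its objective term and the feasibility step \<open>e\<close>.
Multiply stationarity by \<open>d\<close>. Both steps give the same linearized equality constraint, so \<open>d\<close> can be
replaced by \<open>e\<close> in the \<open>\<mu>\<close>-term. In the \<open>Y\<close>-term, \<open>d\<close> satisfies complementarity while \<open>e\<close> is merely
feasible, so self-duality of the psd cone makes the replacement an inequality in the right
direction.\<close>

lemma opt_step_energy:
  assumes sol: "fea_feasible h G x e r s t" and d: "opt_feasible h G x r s t d"
    and mult: "opt_multipliers f h G x \<rho> B t d \<mu> Y"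
  shows "d \<bullet> (B *v d) \<le> - \<rho> * (grad f x \<bullet> d) - \<mu> \<bullet> (Jac h x *v e) - mat_inner Y (DG G x e)"
proof -
  have Y: "psd Y" "mat_inner Y (G x + DG G x d - mat t) = 0"
    and eq: "\<rho> *\<^sub>R grad f x + B *v d + transpose (Jac h x) *v \<mu> + DG_adj G x Y = 0"
    using mult by (auto simp: opt_multipliers_def)
  have "0 = (\<rho> *\<^sub>R grad f x + B *v d + transpose (Jac h x) *v \<mu> + DG_adj G x Y) \<bullet> d"
    unfolding eq by simp
  also have "\<dots> = \<rho> * (grad f x \<bullet> d) + d \<bullet> (B *v d) + \<mu> \<bullet> (Jac h x *v d) + mat_inner Y (DG G x d)"
    unfolding inner_add_left mat_inner_DG
    by (simp add: dot_lmul_matrix inner_commute[of "B *v d" d])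
  finally have "d \<bullet> (B *v d) = - \<rho> * (grad f x \<bullet> d) - \<mu> \<bullet> (Jac h x *v d) - mat_inner Y (DG G x d)"
    by simp
  moreover have "Jac h x *v d = Jac h x *v e"
    using sol d by (metis add_left_cancel fea_feasible_def opt_feasible_def)
  moreover have "mat_inner Y (DG G x e) \<le> mat_inner Y (DG G x d)"
  proof -
    have "psd (mat t - (G x + DG G x e))"
      using sol by (simp add: fea_feasible_def loewner_le_def)
    then have "0 \<le> mat_inner Y (mat t - (G x + DG G x e))"
      by (rule mat_inner_psd_nonneg[OF Y(1)])
    with Y(2) show ?thesis by (simp add: mat_inner_bilinear)
  qed
  ultimately show ?thesis by simp
qed

section \<open>The penalty parameter\<close>

text \<open>Every update of the penalty parameter multiplies it by at most \<open>\<delta>\<close>; if it is kept, both tests that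
trigger an update have failed, which bounds the multipliers of the second subproblem and compares the
two predicted reductions.\<close>

lemma rho_next_cases:
  assumes "0 < \<delta>" "\<delta> < 1" "0 < it_rho I"
  shows "rho_next f h G \<epsilon> \<delta> I \<le> \<delta> * it_rho I \<or>
    (rho_next f h G \<epsilon> \<delta> I = it_rho I \<and>
     it_rho I * (infnorm (it_muhat I) + trace (it_Yhat I)) \<le> 1 \<and>
     \<epsilon> * lin_viol_red h G (it_x I) (it_d I) \<le> lin_pen_red f h G (it_x I) (it_rho I) (it_d I))"
proof -
  have mid: "rho_mid \<epsilon> \<delta> I \<le> \<delta> * it_rho I \<or>
      (rho_mid \<epsilon> \<delta> I = it_rho I \<and> it_rho I * (infnorm (it_muhat I) + trace (it_Yhat I)) \<le> 1)"
    by (auto simp: rho_mid_def Let_def)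
  have le: "\<delta> * rho_mid \<epsilon> \<delta> I \<le> \<delta> * it_rho I"
  proof (intro mult_left_mono)
    have "\<delta> * it_rho I \<le> it_rho I" using assms by simp
    then show "rho_mid \<epsilon> \<delta> I \<le> it_rho I" using mid by linarith
  qed (use assms in simp)
  show ?thesis
  proof (cases "lin_pen_red f h G (it_x I) (rho_mid \<epsilon> \<delta> I) (it_d I) < \<epsilon> * lin_viol_red h G (it_x I) (it_d I)")
    case True
    then have "rho_next f h G \<epsilon> \<delta> I \<le> \<delta> * rho_mid \<epsilon> \<delta> I"
      by (simp add: rho_next_def Let_def)
    with le show ?thesis by simp
  next
    case False
    then have "rho_next f h G \<epsilon> \<delta> I = rho_mid \<epsilon> \<delta> I"
      by (simp add: rho_next_def Let_def)
    with mid False show ?thesis by auto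
  qed
qed

text \<open>A positive limit is incompatible with infinitely many reductions by the factor \<open>\<delta> < 1\<close>, so the
sequence is eventually constant.\<close>

lemma eventually_no_geometric_reduction:
  fixes \<rho> :: "nat \<Rightarrow> real"
  assumes lim: "\<rho> \<longlonglongrightarrow> \<rho>star" "0 < \<rho>star" and \<delta>: "0 < \<delta>" "\<delta> < 1"
    and step: "\<And>k. 0 < \<rho> k \<Longrightarrow> \<rho> (Suc k) \<le> \<delta> * \<rho> k \<or> (\<rho> (Suc k) = \<rho> k \<and> P k)"
  shows "\<exists>N. \<forall>k\<ge>N. \<rho> k = \<rho>star \<and> P k"
proof -
  have "(\<lambda>k. \<rho> (Suc k) - \<delta> * \<rho> k) \<longlonglongrightarrow> \<rho>star - \<delta> * \<rho>star"
    using lim(1) by (intro tendsto_intros LIMSEQ_Suc)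
  moreover have "0 < \<rho>star - \<delta> * \<rho>star" using lim(2) \<delta> by simp
  ultimately have "\<forall>\<^sub>F k in sequentially. 0 < \<rho> (Suc k) - \<delta> * \<rho> k"
    by (rule order_tendstoD)
  moreover have "\<forall>\<^sub>F k in sequentially. 0 < \<rho> k"
    using lim by (rule order_tendstoD)
  ultimately have "\<forall>\<^sub>F k in sequentially. \<rho> (Suc k) = \<rho> k \<and> P k"
    by eventually_elim (use step in fastforce)
  then obtain N where N: "\<And>k. N \<le> k \<Longrightarrow> \<rho> (Suc k) = \<rho> k \<and> P k"
    by (auto simp: eventually_sequentially)
  have const: "\<rho> k = \<rho> N" if "N \<le> k" for k
    using that by (induction k rule: dec_induct) (use N in auto)
  have "\<rho> \<longlonglongrightarrow> \<rho> N"
    by (rule tendsto_eventually, rule eventually_sequentiallyI[of N], erule const)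
  then have "\<rho> N = \<rho>star"
    using lim(1) by (rule LIMSEQ_unique)
  then have "\<rho> k = \<rho>star \<and> P k" if "N \<le> k" for k
    using N[OF that] const[OF that] by simp
  then show ?thesis by blast
qed

section \<open>The line search\<close>

text \<open>If the step is not \<open>1\<close>, the previous trial \<open>a / \<gamma>\<close> was rejected; confronting the rejected inequality
with the quadratic model bounds \<open>a / \<gamma>\<close> from below.\<close>

lemma backtracking_step_ge:
  assumes bt: "backtracking_step f h G \<eta> \<gamma> \<rho> x d a"
    and model: "\<And>b. 0 \<le> b \<Longrightarrow> b \<le> 1 \<Longrightarrow>
      penalty f h G \<rho> (x + b *\<^sub>R d) - penalty f h G \<rho> x \<le> - b * \<Delta> + C * b\<^sup>2"
    and \<Delta>: "\<Delta> = lin_pen_red f h G x \<rho> d" and C: "0 < C" and \<gamma>: "0 < \<gamma>" "\<gamma> < 1"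
  shows "0 < a" "a \<le> 1" "a = 1 \<or> \<gamma> * ((1 - \<eta>) * \<Delta> / C) \<le> a"
proof -
  obtain j where j: "a = \<gamma> ^ j" "\<And>i. i < j \<Longrightarrow> \<not> sufficient_decrease f h G \<eta> \<rho> x d (\<gamma> ^ i)"
    using bt unfolding backtracking_step_def by blast
  show "0 < a" "a \<le> 1" using j(1) \<gamma> by (auto simp: power_le_one)
  show "a = 1 \<or> \<gamma> * ((1 - \<eta>) * \<Delta> / C) \<le> a"
  proof (cases j)
    case 0
    then show ?thesis using j(1) by simp
  next
    case (Suc i)
    define b where "b = \<gamma> ^ i"
    have b: "0 < b" "b \<le> 1" using \<gamma> by (auto simp: b_def power_le_one)
    have "- \<eta> * b * \<Delta> < penalty f h G \<rho> (x + b *\<^sub>R d) - penalty f h G \<rho> x"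
      using j(2)[of i] Suc by (simp add: sufficient_decrease_def \<Delta> b_def)
    also have "\<dots> \<le> - b * \<Delta> + C * b\<^sup>2"
      using b by (intro model) auto
    finally have "b * ((1 - \<eta>) * \<Delta>) < b * (C * b)"
      by (simp add: algebra_simps power2_eq_square)
    then have "(1 - \<eta>) * \<Delta> < C * b"
      using b by (metis mult_less_cancel_left_pos)
    then have "(1 - \<eta>) * \<Delta> / C < b"
      using C by (simp add: pos_divide_less_eq mult.commute)
    then have "\<gamma> * ((1 - \<eta>) * \<Delta> / C) \<le> \<gamma> * b"
      using \<gamma> by (intro mult_left_mono) auto
    then show ?thesis using j(1) Suc by (simp add: b_def)
  qed
qed

text \<open>The values \<open>P k\<close> decrease and are bounded below, so \<open>a k * \<Delta> k\<close> tends to \<open>0\<close>. As \<open>a k\<close> is \<open>1\<close> or at least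
a multiple of \<open>\<Delta> k\<close>, this product dominates \<open>min (\<Delta> k) (c * (\<Delta> k)\<^sup>2)\<close>.\<close>

lemma Armijo_decrease_tendsto_0:
  fixes P a \<Delta> :: "nat \<Rightarrow> real"
  assumes step: "\<And>k. P (Suc k) - P k \<le> - \<eta> * a k * \<Delta> k" and bounded: "\<And>k. m \<le> P k"
    and a: "\<And>k. 0 < a k" "\<And>k. a k = 1 \<or> c * \<Delta> k \<le> a k"
    and \<Delta>: "\<And>k. 0 \<le> \<Delta> k" and pos: "0 < \<eta>" "0 < c"
  shows "\<Delta> \<longlonglongrightarrow> 0"
proof -
  have red: "0 \<le> \<eta> * a k * \<Delta> k" for k
    using a(1)[of k] \<Delta>[of k] pos by simp
  have "decseq P"
    unfolding decseq_Suc_iff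
  proof
    show "P (Suc k) \<le> P k" for k
      using step[of k] red[of k] by simp
  qed
  then obtain p where "P \<longlonglongrightarrow> p"
    using decseq_convergent[of P m] bounded by blast
  then have "(\<lambda>k. (P k - P (Suc k)) / \<eta>) \<longlonglongrightarrow> (p - p) / \<eta>"
    using pos by (intro tendsto_intros LIMSEQ_Suc) auto
  then have lim: "(\<lambda>k. (P k - P (Suc k)) / \<eta>) \<longlonglongrightarrow> 0" by simp
  have ub: "a k * \<Delta> k \<le> (P k - P (Suc k)) / \<eta>" for k
    using step[of k] pos by (simp add: field_simps)
  show ?thesis
  proof (rule LIMSEQ_I)
    fix e :: real assume e: "0 < e"
    have "0 < min e (c * e\<^sup>2)" using e pos by simp
    then have "\<forall>\<^sub>F k in sequentially. (P k - P (Suc k)) / \<eta> < min e (c * e\<^sup>2)"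
      by (rule order_tendstoD(2)[OF lim])
    then have "\<forall>\<^sub>F k in sequentially. \<Delta> k < e"
    proof eventually_elim
      case (elim k)
      show ?case
      proof (rule ccontr)
        assume "\<not> \<Delta> k < e"
        then have ge: "e \<le> \<Delta> k" by simp
        \<comment> \<open>a reduction of at least \<open>e\<close> would force this much decrease of \<open>P\<close>\<close>
        have "min e (c * e\<^sup>2) \<le> a k * \<Delta> k"
        proof (cases "a k = 1")
          case True
          then show ?thesis using ge by simp
        next
          case False
          then have "c * e\<^sup>2 \<le> (c * \<Delta> k) * \<Delta> k"
            using mult_mono[OF ge ge] e pos \<Delta>[of k] by (simp add: power2_eq_square mult.assoc)
          also have "\<dots> \<le> a k * \<Delta> k"
            using a(2)[of k] False \<Delta>[of k] by (intro mult_right_mono) auto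
          finally show ?thesis by simp
        qed
        with ub[of k] elim show False by linarith
      qed
    qed
    then show "\<exists>N. \<forall>k\<ge>N. norm (\<Delta> k - 0) < e"
      using \<Delta> by (auto simp: eventually_sequentially)
  qed
qed

section \<open>Passing to the limit in the optimality conditions\<close>

lemma limit_eq_0:
  fixes g :: "nat \<Rightarrow> 'a::real_normed_vector"
  assumes "g \<longlonglongrightarrow> L" "\<And>k. g k = 0"
  shows "L = 0"
proof -
  have "g = (\<lambda>_. 0)" using assms(2) by auto
  with assms(1) show ?thesis by (simp add: LIMSEQ_const_iff)
qed

lemma fea_solution_t_limit:
  assumes C2: "C2 G" and sym: "\<And>x. symmetric_matrix (G x)"
    and sol: "\<And>k. fea_solution h G (x k) (B k) (e k) (r k) (s k) (t k)"
    and lim: "x \<longlonglongrightarrow> x'" "e \<longlonglongrightarrow> 0"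
  shows "t \<longlonglongrightarrow> max 0 (lambda1 (G x'))"
proof -
  have "(\<lambda>k. G (x k) + DG G (x k) (e k)) \<longlonglongrightarrow> G x' + DG G x' 0"
    by (intro tendsto_add C2_tendsto[OF C2] tendsto_DG[OF C2] lim)
  then have "(\<lambda>k. G (x k) + DG G (x k) (e k)) \<longlonglongrightarrow> G x'"
    by (simp add: linear_0[OF DG_linear])
  then have "(\<lambda>k. max 0 (lambda1 (G (x k) + DG G (x k) (e k)))) \<longlonglongrightarrow> max 0 (lambda1 (G x'))"
    by (intro tendsto_max tendsto_const tendsto_lambda1 symmetric_matrix_add DG_symmetric C2 sym)
  moreover have "t k = max 0 (lambda1 (G (x k) + DG G (x k) (e k)))" for k
    using sol fea_solution_t by blast
  ultimately show ?thesis by presburger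
qed

text \<open>Once the feasibility steps vanish, the optimality conditions of the first subproblem turn into
those of minimizing the violation, since all terms are continuous in the iterate and in the
multipliers.\<close>

lemma infeasible_stationary_limit:
  fixes h :: "real^'n \<Rightarrow> real^'l" and G :: "real^'n \<Rightarrow> real^'m^'m"
  assumes C2: "C2 h" "C2 G" and sym: "\<And>x. symmetric_matrix (G x)"
    and sol: "\<And>k. fea_solution h G (x k) (B k) (e k) (r k) (s k) (t k)"
    and mult: "\<And>k. fea_multipliers h G (x k) (B k) (e k) (r k) (s k) (t k) (\<mu> k) (Y k)"
    and B: "\<And>k. symmetric_matrix (B k)"
    and lim: "x \<longlonglongrightarrow> x'" "e \<longlonglongrightarrow> 0" "B \<longlonglongrightarrow> B'" "\<mu> \<longlonglongrightarrow> \<mu>'" "Y \<longlonglongrightarrow> Y'"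
    and pos: "0 < violation h G x'"
  shows "infeasible_stationary h G x'"
proof -
  note KKT = fea_multipliers_KKT[OF mult B]
  have feas: "fea_feasible h G (x k) (e k) (r k) (s k) (t k)" for k
    using sol by (simp add: fea_solution_def)
  have t: "t \<longlonglongrightarrow> max 0 (lambda1 (G x'))"
    by (rule fea_solution_t_limit[OF C2(2) sym sol lim(1,2)])
  have hlim: "(\<lambda>k. h (x k) + Jac h (x k) *v e k) \<longlonglongrightarrow> h x' + Jac h x' *v 0"
    by (intro tendsto_add C2_tendsto[OF C2(1)] tendsto_matrix_vector_mult tendsto_Jac[OF C2(1)] lim)
  have hlim: "(\<lambda>k. (h (x k) + Jac h (x k) *v e k) $ i) \<longlonglongrightarrow> h x' $ i" for i
    using tendsto_vec_nth[OF hlim, of i] by simp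
  have \<mu>lim: "(\<lambda>k. \<mu> k $ i) \<longlonglongrightarrow> \<mu>' $ i" for i
    by (intro tendsto_vec_nth lim)
  have compl: "(1 - \<mu> k) * pos_part (h (x k) + Jac h (x k) *v e k) = 0"
    "(1 + \<mu> k) * neg_part (h (x k) + Jac h (x k) *v e k) = 0" for k
    using feas[of k] KKT(5,6)[of k] unfolding fea_feasible_def
    by (auto intro!: complementarity_pos_part)
  have "(\<lambda>k. B k *v e k + transpose (Jac h (x k)) *v \<mu> k + DG_adj G (x k) (Y k))
      \<longlonglongrightarrow> B' *v 0 + transpose (Jac h x') *v \<mu>' + DG_adj G x' Y'"
    by (intro tendsto_add tendsto_matrix_vector_mult tendsto_transpose tendsto_Jac tendsto_DG_adj C2 lim)
  then have "B' *v 0 + transpose (Jac h x') *v \<mu>' + DG_adj G x' Y' = 0"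
    by (rule limit_eq_0) (rule KKT(1))
  moreover have "(1 - \<mu>') * pos_part (h x') = 0"
  proof -
    have "(1 - \<mu>' $ i) * max 0 (h x' $ i) = 0" for i
    proof (rule limit_eq_0)
      show "(\<lambda>k. (1 - \<mu> k $ i) * max 0 ((h (x k) + Jac h (x k) *v e k) $ i)) \<longlonglongrightarrow> (1 - \<mu>' $ i) * max 0 (h x' $ i)"
        by (intro tendsto_mult tendsto_diff tendsto_const tendsto_max \<mu>lim hlim)
      show "(1 - \<mu> k $ i) * max 0 ((h (x k) + Jac h (x k) *v e k) $ i) = 0" for k
        using arg_cong[OF compl(1)[of k], of "\<lambda>y. y $ i"] by (simp add: pos_part_def)
    qed
    then show ?thesis by (simp add: vec_eq_iff pos_part_def)
  qed
  moreover have "(1 + \<mu>') * neg_part (h x') = 0"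
  proof -
    have "(1 + \<mu>' $ i) * min 0 (h x' $ i) = 0" for i
    proof (rule limit_eq_0)
      show "(\<lambda>k. (1 + \<mu> k $ i) * min 0 ((h (x k) + Jac h (x k) *v e k) $ i)) \<longlonglongrightarrow> (1 + \<mu>' $ i) * min 0 (h x' $ i)"
        by (intro tendsto_mult tendsto_add tendsto_const tendsto_min \<mu>lim hlim)
      show "(1 + \<mu> k $ i) * min 0 ((h (x k) + Jac h (x k) *v e k) $ i) = 0" for k
        using arg_cong[OF compl(2)[of k], of "\<lambda>y. y $ i"] by (simp add: neg_part_def)
    qed
    then show ?thesis by (simp add: vec_eq_iff neg_part_def)
  qed
  moreover have "(1 - trace Y') * max 0 (lambda1 (G x')) = 0"
  proof (rule limit_eq_0)
    show "(\<lambda>k. (1 - trace (Y k)) * t k) \<longlonglongrightarrow> (1 - trace Y') * max 0 (lambda1 (G x'))"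
      by (intro tendsto_mult tendsto_diff tendsto_const tendsto_trace t lim)
  qed (rule KKT(7))
  moreover have "mat_inner Y' (G x' + DG G x' 0 - mat (max 0 (lambda1 (G x')))) = 0"
  proof (rule limit_eq_0)
    show "(\<lambda>k. mat_inner (Y k) (G (x k) + DG G (x k) (e k) - mat (t k)))
        \<longlonglongrightarrow> mat_inner Y' (G x' + DG G x' 0 - mat (max 0 (lambda1 (G x'))))"
      by (intro tendsto_mat_inner tendsto_diff tendsto_add tendsto_mat tendsto_DG C2_tendsto[OF C2(2)] C2 t lim)
    show "mat_inner (Y k) (G (x k) + DG G (x k) (e k) - mat (t k)) = 0" for k
      using mult by (simp add: fea_multipliers_def)
  qed
  moreover have "- 1 \<le> \<mu>'" "\<mu>' \<le> 1"
    unfolding less_eq_vec_def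
  proof (safe)
    fix i
    have "- 1 \<le> \<mu> k $ i" "\<mu> k $ i \<le> 1" for k
      using KKT(2,3)[of k] by (simp_all add: less_eq_vec_def)
    then show "(- 1) $ i \<le> \<mu>' $ i" "\<mu>' $ i \<le> 1 $ i"
      using LIMSEQ_le_const[OF \<mu>lim] LIMSEQ_le_const2[OF \<mu>lim] by auto
  qed
  moreover have "psd Y'"
    using mult by (intro psd_limit[OF _ lim(5)]) (simp add: fea_multipliers_def)
  moreover have "trace Y' \<le> 1"
    using KKT(4) by (intro LIMSEQ_le_const2[OF tendsto_trace[OF lim(5)]]) auto
  ultimately show ?thesis
    unfolding infeasible_stationary_def using pos by (auto simp: linear_0[OF DG_linear] simp del: transpose_matrix_vector)
qed

text \<open>The second subproblem weights the objective by \<open>\<rho>\<close>; dividing the limiting multipliers by this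
positive number gives multipliers of the shifted problem.\<close>

lemma shifted_KKT_limit:
  fixes h :: "real^'n \<Rightarrow> real^'l" and G :: "real^'n \<Rightarrow> real^'m^'m"
  assumes C2: "C2 f" "C2 h" "C2 G" and sym: "\<And>x. symmetric_matrix (G x)" and \<rho>: "0 < \<rho>"
    and mult: "\<And>k. opt_multipliers f h G (x k) \<rho> (B k) (t k) (d k) (\<mu> k) (Y k)"
    and lim: "x \<longlonglongrightarrow> x'" "d \<longlonglongrightarrow> 0" "B \<longlonglongrightarrow> B'" "\<mu> \<longlonglongrightarrow> \<mu>'" "Y \<longlonglongrightarrow> Y'"
      "t \<longlonglongrightarrow> max 0 (lambda1 (G x'))"
  shows "shifted_KKT_point f h G (pos_part (h x')) (- neg_part (h x')) (max 0 (lambda1 (G x'))) x'"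
proof -
  have "(\<lambda>k. \<rho> *\<^sub>R grad f (x k) + B k *v d k + transpose (Jac h (x k)) *v \<mu> k + DG_adj G (x k) (Y k))
      \<longlonglongrightarrow> \<rho> *\<^sub>R grad f x' + B' *v 0 + transpose (Jac h x') *v \<mu>' + DG_adj G x' Y'"
    by (intro tendsto_add tendsto_scaleR tendsto_const tendsto_matrix_vector_mult tendsto_transpose
        tendsto_grad tendsto_Jac tendsto_DG_adj C2 lim)
  then have "\<rho> *\<^sub>R grad f x' + B' *v 0 + transpose (Jac h x') *v \<mu>' + DG_adj G x' Y' = 0"
    by (rule limit_eq_0) (use mult in \<open>simp add: opt_multipliers_def\<close>)
  then have "(1 / \<rho>) *\<^sub>R (\<rho> *\<^sub>R grad f x' + transpose (Jac h x') *v \<mu>' + DG_adj G x' Y') = 0"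
    by simp
  then have stat: "grad f x' + transpose (Jac h x') *v ((1 / \<rho>) *\<^sub>R \<mu>') + DG_adj G x' ((1 / \<rho>) *\<^sub>R Y') = 0"
    using \<rho> by (simp add: scaleR_add_right matrix_vector_mult_scaleR DG_adj_scaleR del: transpose_matrix_vector)
  have "mat_inner Y' (G x' + DG G x' 0 - mat (max 0 (lambda1 (G x')))) = 0"
  proof (rule limit_eq_0)
    show "(\<lambda>k. mat_inner (Y k) (G (x k) + DG G (x k) (d k) - mat (t k)))
        \<longlonglongrightarrow> mat_inner Y' (G x' + DG G x' 0 - mat (max 0 (lambda1 (G x'))))"
      by (intro tendsto_mat_inner tendsto_diff tendsto_add tendsto_mat tendsto_DG C2_tendsto[OF C2(3)] C2 lim)
    show "mat_inner (Y k) (G (x k) + DG G (x k) (d k) - mat (t k)) = 0" for k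
      using mult by (simp add: opt_multipliers_def)
  qed
  then have "mat_inner ((1 / \<rho>) *\<^sub>R Y') (G x' - mat (max 0 (lambda1 (G x')))) = 0"
    by (simp add: linear_0[OF DG_linear] mat_inner_bilinear)
  moreover have "psd ((1 / \<rho>) *\<^sub>R Y')"
    using mult \<rho> by (intro psd_scaleR psd_limit[OF _ lim(5)]) (simp_all add: opt_multipliers_def)
  moreover have "h x' = pos_part (h x') - (- neg_part (h x'))"
    using pos_part_plus_neg_part[of "h x'"] by simp
  moreover have "G x' \<preceq>\<^sub>L mat (max 0 (lambda1 (G x')))"
    by (simp add: loewner_le_mat_iff sym)
  ultimately show ?thesis
    unfolding shifted_KKT_point_def using stat by blast
qed

section \<open>Runs with a constant penalty parameter\<close>

text \<open>A tail of a run along which the penalty parameter stays constant. The last two assumptions are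
what the failure of the two tests for decreasing it provides: bounded multipliers of the second
subproblem, and a predicted reduction of the penalty comparable with that of the violation.\<close>

locale stable_sqp_run =
  fixes f :: "real^'n \<Rightarrow> real"
    and h :: "real^'n \<Rightarrow> real^'l"
    and G :: "real^'n \<Rightarrow> real^'m^'m"
    and I :: "nat \<Rightarrow> ('n, 'l, 'm) sqp_iterate"
    and \<epsilon> \<delta> \<eta> \<gamma> b1 b2 \<rho> :: real
    and \<Omega> :: "(real^'n) set"
  assumes sym: "\<And>x. symmetric_matrix (G x)"
    and C2: "C2 f" "C2 h" "C2 G"
    and \<epsilon>: "0 < \<epsilon>" and \<eta>: "0 < \<eta>" "\<eta> < 1" and \<gamma>: "0 < \<gamma>" "\<gamma> < 1"
    and \<Omega>: "compact \<Omega>" "\<And>k. it_x (I k) \<in> \<Omega>"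
    and b1: "0 < b1"
    and elliptic: "\<And>k. uniformly_elliptic b1 b2 (it_Bfea (I k))" "\<And>k. uniformly_elliptic b1 b2 (it_B (I k))"
    and \<rho>: "0 < \<rho>" "\<And>k. it_rho (I k) = \<rho>"
    and step: "\<And>k. sqp_step f h G \<epsilon> \<delta> \<eta> \<gamma> (I k) (it_x (I (Suc k))) \<rho>"
    and multiplier_bound: "\<And>k. \<rho> * (infnorm (it_muhat (I k)) + trace (it_Yhat (I k))) \<le> 1"
    and model_bound: "\<And>k. \<epsilon> * lin_viol_red h G (it_x (I k)) (it_d (I k))
      \<le> lin_pen_red f h G (it_x (I k)) \<rho> (it_d (I k))"
begin

abbreviation "x k \<equiv> it_x (I k)"
abbreviation "e k \<equiv> it_dfea (I k)"
abbreviation "d k \<equiv> it_d (I k)"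

lemma fea_sol: "fea_solution h G (x k) (it_Bfea (I k)) (e k) (it_r (I k)) (it_s (I k)) (it_t (I k))"
  and fea_mult: "fea_multipliers h G (x k) (it_Bfea (I k)) (e k) (it_r (I k)) (it_s (I k)) (it_t (I k))
    (it_mubar (I k)) (it_Ybar (I k))"
  and opt_sol: "opt_solution f h G (x k) \<rho> (it_B (I k)) (it_r (I k)) (it_s (I k)) (it_t (I k)) (d k)"
  and opt_mult: "opt_multipliers f h G (x k) \<rho> (it_B (I k)) (it_t (I k)) (d k) (it_muhat (I k)) (it_Yhat (I k))"
  and backtracking: "backtracking_step f h G \<eta> \<gamma> \<rho> (x k) (d k) (it_alpha (I k))"
  and update: "x (Suc k) = x k + it_alpha (I k) *\<^sub>R d k"
  and psd_Bfea: "psd (it_Bfea (I k))" and psd_B: "psd (it_B (I k))"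
  using step[of k] \<rho>(2)[of k]
  by (auto simp: sqp_step_def pos_def_def psd_def) (metis inner_zero_left less_eq_real_def)+

lemma psd_Yhat: "psd (it_Yhat (I k))"
  using opt_mult by (simp add: opt_multipliers_def)

lemma trace_Yhat_le: "trace (it_Yhat (I k)) \<le> 1 / \<rho>"
  and muhat_le: "\<bar>it_muhat (I k) $ i\<bar> \<le> 1 / \<rho>"
proof -
  have "infnorm (it_muhat (I k)) + trace (it_Yhat (I k)) \<le> 1 / \<rho>"
    using multiplier_bound[of k] \<rho>(1) by (simp add: field_simps)
  then show "trace (it_Yhat (I k)) \<le> 1 / \<rho>" "\<bar>it_muhat (I k) $ i\<bar> \<le> 1 / \<rho>"
    using infnorm_pos_le[of "it_muhat (I k)"] psd_trace_nonneg[OF psd_Yhat, of k]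
      component_le_infnorm_cart[of "it_muhat (I k)" i] by linarith+
qed

text \<open>Bounds the feasibility step by the linear reduction that it makes possible, which the line search
later forces to zero.\<close>

lemma fea_step_energy: "b1 * (norm (e k))\<^sup>2 \<le> 2 * lin_viol_red h G (x k) (d k)"
proof -
  have "1/2 * (e k \<bullet> (it_Bfea (I k) *v e k)) \<le> lin_viol_red h G (x k) (d k)"
    by (rule fea_solution_lin_viol_red[OF fea_sol _ sym]) (use opt_sol in \<open>auto simp: opt_solution_def\<close>)
  moreover have "b1 * (norm (e k))\<^sup>2 \<le> e k \<bullet> (it_Bfea (I k) *v e k)"
    using elliptic(1) by (simp add: uniformly_elliptic_def)
  ultimately show ?thesis by linarith
qed

lemma lin_viol_red_nonneg: "0 \<le> lin_viol_red h G (x k) (d k)"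
  using fea_step_energy[of k] b1 by (smt (verit) mult_nonneg_nonneg zero_le_power2)

lemma lin_pen_red_nonneg: "0 \<le> lin_pen_red f h G (x k) \<rho> (d k)"
  using model_bound[of k] lin_viol_red_nonneg[of k] \<epsilon> by (smt (verit) mult_nonneg_nonneg)

text \<open>Since \<open>\<rho>\<close> does not change, the multipliers in the energy estimate are bounded by \<open>1 / \<rho>\<close>, so their terms are
of the order of the feasibility step.\<close>

lemma opt_step_energy_bound:
  obtains C where "0 \<le> C"
    "\<And>k. b1 * (norm (d k))\<^sup>2 \<le> - \<rho> * (grad f (x k) \<bullet> d k) + C * norm (e k)"
proof -
  obtain Mh where Mh: "0 \<le> Mh" "\<And>x d. x \<in> \<Omega> \<Longrightarrow> norm (Jac h x *v d) \<le> Mh * norm d"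
    using C2_derivative_bounded[OF C2(2) \<Omega>(1)] unfolding Jac_mult_eq_frechet[OF C2(2), symmetric] by blast
  obtain MG where MG: "0 \<le> MG" "\<And>x d. x \<in> \<Omega> \<Longrightarrow> norm (DG G x d) \<le> MG * norm d"
    using C2_derivative_bounded[OF C2(3) \<Omega>(1)] unfolding DG_eq_frechet[OF C2(3), symmetric] by blast
  define c\<mu> cY where "c\<mu> = real CARD('l) * (1 / \<rho>)" and "cY = (real CARD('m))\<^sup>2 * (1 / \<rho>)"
  have c: "0 \<le> c\<mu>" "0 \<le> cY" using \<rho> by (auto simp: c\<mu>_def cY_def)
  show ?thesis
  proof
    show "0 \<le> c\<mu> * Mh + cY * MG" using c Mh(1) MG(1) by simp
    fix k
    have "d k \<bullet> (it_B (I k) *v d k) \<le> - \<rho> * (grad f (x k) \<bullet> d k)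
        - it_muhat (I k) \<bullet> (Jac h (x k) *v e k) - mat_inner (it_Yhat (I k)) (DG G (x k) (e k))"
      using fea_sol opt_sol by (intro opt_step_energy[OF _ _ opt_mult]) (auto simp: fea_solution_def opt_solution_def)
    moreover have "b1 * (norm (d k))\<^sup>2 \<le> d k \<bullet> (it_B (I k) *v d k)"
      using elliptic(2) by (simp add: uniformly_elliptic_def)
    moreover have "\<bar>it_muhat (I k) \<bullet> (Jac h (x k) *v e k)\<bar> \<le> c\<mu> * (Mh * norm (e k))"
    proof -
      have "\<bar>it_muhat (I k) \<bullet> (Jac h (x k) *v e k)\<bar> \<le> norm (it_muhat (I k)) * norm (Jac h (x k) *v e k)"
        by (rule Cauchy_Schwarz_ineq2)
      also have "\<dots> \<le> c\<mu> * (Mh * norm (e k))"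
        unfolding c\<mu>_def by (intro mult_mono norm_le_if_components_le muhat_le Mh \<Omega>) (use \<rho> in auto)
      finally show ?thesis .
    qed
    moreover have "\<bar>mat_inner (it_Yhat (I k)) (DG G (x k) (e k))\<bar> \<le> cY * (MG * norm (e k))"
    proof -
      have "\<bar>mat_inner (it_Yhat (I k)) (DG G (x k) (e k))\<bar> \<le> cY * norm (DG G (x k) (e k))"
        unfolding cY_def
        by (intro abs_mat_inner_le order_trans[OF psd_entry_le_trace[OF psd_Yhat]] trace_Yhat_le)
      also have "\<dots> \<le> cY * (MG * norm (e k))"
        by (intro mult_left_mono MG \<Omega> c)
      finally show ?thesis .
    qed
    ultimately show "b1 * (norm (d k))\<^sup>2 \<le> - \<rho> * (grad f (x k) \<bullet> d k) + (c\<mu> * Mh + cY * MG) * norm (e k)"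
      by (simp add: abs_le_iff algebra_simps)
  qed
qed

lemma violation_bounded: obtains V where "0 \<le> V" "\<And>k. violation h G (x k) \<le> V"
proof -
  have "continuous_on \<Omega> (violation h G)"
    unfolding continuous_on_def by (intro ballI tendsto_violation C2 sym tendsto_ident_at)
  then have "bounded (violation h G ` \<Omega>)"
    using \<Omega>(1) by (intro compact_imp_bounded compact_continuous_image)
  then obtain V where "0 < V" "\<And>y. y \<in> \<Omega> \<Longrightarrow> \<bar>violation h G y\<bar> \<le> V"
    unfolding bounded_pos by force
  then show ?thesis using \<Omega>(2) that[of V] by (smt (verit))
qed

lemma fea_step_bounded: obtains E where "0 \<le> E" "\<And>k. norm (e k) \<le> E"
proof -
  obtain V where V: "0 \<le> V" "\<And>k. violation h G (x k) \<le> V"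
    by (rule violation_bounded) blast
  have "norm (e k) \<le> sqrt (2 * V / b1)" for k
  proof (rule real_le_rsqrt)
    have "0 \<le> lin_viol h G (x k) (d k)"
      by (simp add: lin_viol_def norm1_nonneg add_nonneg_nonneg)
    then have "lin_viol_red h G (x k) (d k) \<le> V"
      using V(2)[of k] by (simp add: lin_viol_red_def lin_viol_0)
    then have "b1 * (norm (e k))\<^sup>2 \<le> 2 * V"
      using fea_step_energy[of k] by linarith
    then show "(norm (e k))\<^sup>2 \<le> 2 * V / b1"
      using b1 by (simp add: field_simps)
  qed
  then show ?thesis using V b1 by (intro that[of "sqrt (2 * V / b1)"]) auto
qed

text \<open>In the inequality \<open>b1 |d|\<^sup>2 \<le> \<rho> M |d| + C E\<close> the left side is quadratic in \<open>|d|\<close> and the right side affine.\<close>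

lemma opt_step_bounded: obtains D where "0 \<le> D" "\<And>k. norm (d k) \<le> D"
proof -
  obtain C where C: "0 \<le> C" "\<And>k. b1 * (norm (d k))\<^sup>2 \<le> - \<rho> * (grad f (x k) \<bullet> d k) + C * norm (e k)"
    by (rule opt_step_energy_bound) blast
  obtain E where E: "0 \<le> E" "\<And>k. norm (e k) \<le> E"
    by (rule fea_step_bounded) blast
  obtain M where M: "0 \<le> M" "\<And>x d. x \<in> \<Omega> \<Longrightarrow> \<bar>grad f x \<bullet> d\<bar> \<le> M * norm d"
    using C2_derivative_bounded[OF C2(1) \<Omega>(1)] unfolding grad_inner_eq_frechet[OF C2(1), symmetric] real_norm_def by blast
  \<comment> \<open>if the step has norm at least one, the inequality may be divided by that norm\<close>
  define D where "D = 1 + (\<rho> * M + C * E) / b1"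
  have frac: "0 \<le> (\<rho> * M + C * E) / b1"
    using \<rho>(1) M(1) C(1) E(1) b1 by simp
  have "norm (d k) \<le> D" for k
  proof (cases "norm (d k) \<le> 1")
    case True
    then show ?thesis using frac by (simp add: D_def)
  next
    case False
    have "- \<rho> * (grad f (x k) \<bullet> d k) \<le> \<rho> * (M * norm (d k))"
      using mult_left_mono[of "- (grad f (x k) \<bullet> d k)" "M * norm (d k)" \<rho>] M(2)[OF \<Omega>(2), of k "d k"] \<rho>(1) by simp
    moreover have "C * norm (e k) \<le> C * E"
      by (intro mult_left_mono E C)
    moreover have "C * E \<le> (C * E) * norm (d k)"
      using mult_left_mono[of 1 "norm (d k)" "C * E"] False C(1) E(1) by simp
    ultimately have "b1 * (norm (d k) * norm (d k)) \<le> (\<rho> * M + C * E) * norm (d k)"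
      using C(2)[of k] by (simp add: power2_eq_square algebra_simps)
    then have "b1 * norm (d k) \<le> \<rho> * M + C * E"
      using False by (metis linorder_not_le mult.assoc mult_right_le_imp_le order_less_trans zero_less_one)
    then show ?thesis
      using b1 by (simp add: D_def field_simps)
  qed
  then show ?thesis
    using frac by (intro that[of D]) (auto simp: D_def)
qed

text \<open>The steps are bounded, so all trial points stay in one ball on which the quadratic model error is
uniform; with \<open>\<rho>\<close> fixed the line search decreases one and the same function, which is bounded below
on \<open>\<Omega>\<close>.\<close>

lemma lin_pen_red_tendsto_0: "(\<lambda>k. lin_pen_red f h G (x k) \<rho> (d k)) \<longlonglongrightarrow> 0"
proof -
  obtain D where D: "0 \<le> D" "\<And>k. norm (d k) \<le> D"
    by (rule opt_step_bounded) blast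
  obtain R where R: "\<And>y. y \<in> \<Omega> \<Longrightarrow> norm y \<le> R"
    using compact_imp_bounded[OF \<Omega>(1)] unfolding bounded_iff by blast
  let ?K = "cball 0 (R + D) :: (real^'n) set"
  have K: "x k \<in> ?K" "x k + d k \<in> ?K" for k
    using R[OF \<Omega>(2), of k] D(1) D(2)[of k] norm_triangle_ineq[of "x k" "d k"] by auto
  obtain C where C: "0 \<le> C"
    "\<And>x d a. x \<in> ?K \<Longrightarrow> x + d \<in> ?K \<Longrightarrow> 0 \<le> a \<Longrightarrow> a \<le> 1 \<Longrightarrow>
      penalty f h G \<rho> (x + a *\<^sub>R d) - penalty f h G \<rho> x \<le> - a * lin_pen_red f h G x \<rho> d + C * (a * norm d)\<^sup>2"
    using penalty_model_decrease[OF C2 sym compact_cball convex_cball, of \<rho> 0 "R + D"] \<rho>(1) by (metis less_imp_le)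
  \<comment> \<open>the summand one only makes the constant positive\<close>
  define C' where "C' = C * D\<^sup>2 + 1"
  have C': "0 < C'" using C(1) by (simp add: C'_def add_nonneg_pos)
  have model: "penalty f h G \<rho> (x k + b *\<^sub>R d k) - penalty f h G \<rho> (x k)
      \<le> - b * lin_pen_red f h G (x k) \<rho> (d k) + C' * b\<^sup>2" if b: "0 \<le> b" "b \<le> 1" for b k
  proof -
    have "C * (b * norm (d k))\<^sup>2 \<le> C * (b * D)\<^sup>2"
      using b C(1) D(2)[of k] by (intro mult_left_mono power_mono) auto
    also have "\<dots> \<le> C' * b\<^sup>2"
      by (simp add: C'_def power_mult_distrib algebra_simps)
    finally show ?thesis
      using C(2)[OF K b, of k] by linarith
  qed
  have "bounded (f ` \<Omega>)"
    by (intro compact_imp_bounded compact_continuous_image C2_continuous_on C2 \<Omega>)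
  then obtain Mf where Mf: "\<And>y. y \<in> \<Omega> \<Longrightarrow> \<bar>f y\<bar> \<le> Mf"
    unfolding bounded_iff by auto
  note ls = backtracking_step_ge[OF backtracking model refl C' \<gamma>]
  show ?thesis
  proof (rule Armijo_decrease_tendsto_0)
    show "penalty f h G \<rho> (x (Suc k)) - penalty f h G \<rho> (x k)
        \<le> - \<eta> * it_alpha (I k) * lin_pen_red f h G (x k) \<rho> (d k)" for k
      using backtracking[of k] unfolding backtracking_step_def sufficient_decrease_def update by auto
    show "\<rho> * (- Mf) \<le> penalty f h G \<rho> (x k)" for k
    proof -
      have "\<rho> * (- Mf) \<le> \<rho> * f (x k)"
        using Mf[OF \<Omega>(2), of k] \<rho>(1) by (intro mult_left_mono) auto
      then show ?thesis using violation_nonneg[of h G "x k"] by (simp add: penalty_def)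
    qed
    show "0 < it_alpha (I k)" for k by (rule ls(1))
    show "it_alpha (I k) = 1 \<or> (\<gamma> * (1 - \<eta>) / C') * lin_pen_red f h G (x k) \<rho> (d k) \<le> it_alpha (I k)" for k
      using ls(3)[of k] by (simp add: mult.assoc)
    show "0 < \<gamma> * (1 - \<eta>) / C'" using \<gamma> \<eta> C' by simp
  qed (use lin_pen_red_nonneg \<eta> in auto)
qed

lemma lin_viol_red_tendsto_0: "(\<lambda>k. lin_viol_red h G (x k) (d k)) \<longlonglongrightarrow> 0"
proof (rule Lim_null_comparison)
  show "(\<lambda>k. lin_pen_red f h G (x k) \<rho> (d k) / \<epsilon>) \<longlonglongrightarrow> 0"
    using tendsto_divide[OF lin_pen_red_tendsto_0 tendsto_const, of \<epsilon>] \<epsilon> by simp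
  show "\<forall>\<^sub>F k in sequentially. norm (lin_viol_red h G (x k) (d k)) \<le> lin_pen_red f h G (x k) \<rho> (d k) / \<epsilon>"
    using model_bound lin_viol_red_nonneg \<epsilon> by (intro always_eventually allI) (simp add: field_simps)
qed

lemma fea_step_tendsto_0: "e \<longlonglongrightarrow> 0"
  using tendsto_mult[OF tendsto_const lin_viol_red_tendsto_0, of 2]
  by (intro tendsto_0_if_norm_square_le[OF b1 fea_step_energy]) simp

text \<open>The objective term \<open>- \<rho> (grad f \<bullet> d)\<close> is the difference of the two predicted reductions, both of
which vanish in the limit.\<close>

lemma opt_step_tendsto_0: "d \<longlonglongrightarrow> 0"
proof -
  obtain C where C: "0 \<le> C" "\<And>k. b1 * (norm (d k))\<^sup>2 \<le> - \<rho> * (grad f (x k) \<bullet> d k) + C * norm (e k)"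
    by (rule opt_step_energy_bound) blast
  have "(\<lambda>k. lin_pen_red f h G (x k) \<rho> (d k) - lin_viol_red h G (x k) (d k) + C * norm (e k)) \<longlonglongrightarrow> 0 - 0 + C * norm (0::real^'n)"
    by (intro tendsto_intros lin_pen_red_tendsto_0 lin_viol_red_tendsto_0 fea_step_tendsto_0)
  then have "(\<lambda>k. - \<rho> * (grad f (x k) \<bullet> d k) + C * norm (e k)) \<longlonglongrightarrow> 0"
    by (simp add: lin_pen_red_def)
  with b1 C(2) show ?thesis by (rule tendsto_0_if_norm_square_le)
qed

text \<open>All multipliers and model matrices lie in fixed balls, so one subsequence serves for all six.\<close>

lemma convergent_multiplier_subsequence:
  fixes \<phi> :: "nat \<Rightarrow> nat"
  obtains \<psi> \<mu>bar Ybar \<mu>hat Yhat Bfea B where "strict_mono \<psi>"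
    "(\<lambda>k. it_mubar (I (\<phi> (\<psi> k)))) \<longlonglongrightarrow> \<mu>bar" "(\<lambda>k. it_Ybar (I (\<phi> (\<psi> k)))) \<longlonglongrightarrow> Ybar"
    "(\<lambda>k. it_muhat (I (\<phi> (\<psi> k)))) \<longlonglongrightarrow> \<mu>hat" "(\<lambda>k. it_Yhat (I (\<phi> (\<psi> k)))) \<longlonglongrightarrow> Yhat"
    "(\<lambda>k. it_Bfea (I (\<phi> (\<psi> k)))) \<longlonglongrightarrow> Bfea" "(\<lambda>k. it_B (I (\<phi> (\<psi> k)))) \<longlonglongrightarrow> B"
proof -
  let ?Z = "\<lambda>J. ((it_mubar J, it_Ybar J), (it_muhat J, it_Yhat J), (it_Bfea J, it_B J))"
  let ?b = "real CARD('n) * (real CARD('n) * (real CARD('n) * b2))"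
  let ?S = "(cball (0::real^'l) (real CARD('l) * 1) \<times> cball (0::real^'m^'m) (real CARD('m) * (real CARD('m) * 1)))
    \<times> (cball (0::real^'l) (real CARD('l) * (1 / \<rho>)) \<times> cball (0::real^'m^'m) (real CARD('m) * (real CARD('m) * (1 / \<rho>))))
    \<times> (cball (0::real^'n^'n) ?b \<times> cball (0::real^'n^'n) ?b)"
  have "?Z (I k) \<in> ?S" for k
  proof -
    note KKT = fea_multipliers_KKT[OF fea_mult, of k]
    have symB: "symmetric_matrix (it_Bfea (I k))" using psd_Bfea by (simp add: psd_def)
    have "\<bar>it_mubar (I k) $ i\<bar> \<le> 1" for i
      using KKT(2,3)[OF symB] by (simp add: less_eq_vec_def abs_le_iff)
    then have "norm (it_mubar (I k)) \<le> real CARD('l) * 1"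
      by (rule norm_le_if_components_le)
    moreover have "norm (it_Ybar (I k)) \<le> real CARD('m) * (real CARD('m) * 1)"
      using fea_mult[of k] KKT(4)[OF symB]
      by (intro order_trans[OF norm_psd_le_trace] mult_left_mono) (auto simp: fea_multipliers_def)
    moreover have "norm (it_muhat (I k)) \<le> real CARD('l) * (1 / \<rho>)"
      by (intro norm_le_if_components_le muhat_le)
    moreover have "norm (it_Yhat (I k)) \<le> real CARD('m) * (real CARD('m) * (1 / \<rho>))"
      by (intro order_trans[OF norm_psd_le_trace[OF psd_Yhat]] mult_left_mono trace_Yhat_le) auto
    moreover have "norm (it_Bfea (I k)) \<le> ?b" "norm (it_B (I k)) \<le> ?b"
      by (rule norm_elliptic_le[OF psd_Bfea elliptic(1)], rule norm_elliptic_le[OF psd_B elliptic(2)])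
    ultimately show ?thesis by simp
  qed
  then have mem: "\<forall>k. ?Z (I (\<phi> k)) \<in> ?S"
    by (rule allI)
  have cpt: "seq_compact ?S"
    unfolding compact_eq_seq_compact_metric[symmetric] by (intro compact_Times compact_cball)
  obtain l \<psi> where \<psi>: "strict_mono \<psi>" and subseq: "((\<lambda>k. ?Z (I (\<phi> k))) \<circ> \<psi>) \<longlonglongrightarrow> l"
    by (rule seq_compactE[OF cpt mem]) blast
  obtain \<mu>bar Ybar \<mu>hat Yhat Bfea B where l: "l = ((\<mu>bar, Ybar), (\<mu>hat, Yhat), (Bfea, B))"
    by (cases l) auto
  note lim = subseq[unfolded o_def]
  note 1 = tendsto_fst[OF lim, unfolded l fst_conv snd_conv]
    and 2 = tendsto_fst[OF tendsto_snd[OF lim], unfolded l fst_conv snd_conv]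
    and 3 = tendsto_snd[OF tendsto_snd[OF lim], unfolded l fst_conv snd_conv]
  show ?thesis
    by (rule that[OF \<psi> tendsto_fst[OF 1, unfolded fst_conv] tendsto_snd[OF 1, unfolded snd_conv]
          tendsto_fst[OF 2, unfolded fst_conv] tendsto_snd[OF 2, unfolded snd_conv]
          tendsto_fst[OF 3, unfolded fst_conv] tendsto_snd[OF 3, unfolded snd_conv]])
qed

theorem accumulation_point_stationary:
  assumes acc: "accumulation_point x x'" and pos: "0 < violation h G x'"
  shows "infeasible_stationary h G x'"
    and "shifted_KKT_point f h G (pos_part (h x')) (- neg_part (h x')) (max 0 (lambda1 (G x'))) x'"
proof -
  obtain \<phi> where \<phi>: "strict_mono \<phi>" "(\<lambda>k. x (\<phi> k)) \<longlonglongrightarrow> x'"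
    using acc by (auto simp: accumulation_point_def o_def)
  obtain \<psi> \<mu>bar Ybar \<mu>hat Yhat Bfea B where \<psi>: "strict_mono \<psi>" and lim:
    "(\<lambda>k. it_mubar (I (\<phi> (\<psi> k)))) \<longlonglongrightarrow> \<mu>bar" "(\<lambda>k. it_Ybar (I (\<phi> (\<psi> k)))) \<longlonglongrightarrow> Ybar"
    "(\<lambda>k. it_muhat (I (\<phi> (\<psi> k)))) \<longlonglongrightarrow> \<mu>hat" "(\<lambda>k. it_Yhat (I (\<phi> (\<psi> k)))) \<longlonglongrightarrow> Yhat"
    "(\<lambda>k. it_Bfea (I (\<phi> (\<psi> k)))) \<longlonglongrightarrow> Bfea" "(\<lambda>k. it_B (I (\<phi> (\<psi> k)))) \<longlonglongrightarrow> B"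
    by (rule convergent_multiplier_subsequence)
  have mono: "strict_mono (\<lambda>k. \<phi> (\<psi> k))"
    using \<phi>(1) \<psi> by (simp add: strict_mono_def)
  have lim_x: "(\<lambda>k. x (\<phi> (\<psi> k))) \<longlonglongrightarrow> x'"
    using LIMSEQ_subseq_LIMSEQ[OF \<phi>(2) \<psi>] by (simp add: o_def)
  have lim_e: "(\<lambda>k. e (\<phi> (\<psi> k))) \<longlonglongrightarrow> 0" and lim_d: "(\<lambda>k. d (\<phi> (\<psi> k))) \<longlonglongrightarrow> 0"
    using LIMSEQ_subseq_LIMSEQ[OF fea_step_tendsto_0 mono] LIMSEQ_subseq_LIMSEQ[OF opt_step_tendsto_0 mono]
    by (simp_all add: o_def)
  have "symmetric_matrix (it_Bfea (I k))" for k
    using psd_Bfea by (simp add: psd_def)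
  then show "infeasible_stationary h G x'"
    by (intro infeasible_stationary_limit[OF C2(2,3) sym fea_sol fea_mult _ lim_x lim_e lim(5,1,2) pos])
  show "shifted_KKT_point f h G (pos_part (h x')) (- neg_part (h x')) (max 0 (lambda1 (G x'))) x'"
    by (rule shifted_KKT_limit[OF C2 sym \<rho>(1) opt_mult lim_x lim_d lim(6,3,4)
          fea_solution_t_limit[OF C2(3) sym fea_sol lim_x lim_e]])
qed

end

lemma accumulation_point_shift:
  assumes "accumulation_point X p"
  shows "accumulation_point (\<lambda>k. X (k + N)) p"
proof -
  obtain \<phi> where \<phi>: "strict_mono \<phi>" "(\<lambda>k. X (\<phi> k)) \<longlonglongrightarrow> p"
    using assms by (auto simp: accumulation_point_def o_def)
  \<comment> \<open>strict monotonicity gives \<open>\<phi> (k + N) \<ge> k + N\<close>, so the subtraction does not truncate\<close>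
  define \<psi> where "\<psi> = (\<lambda>k. \<phi> (k + N) - N)"
  have ge: "N \<le> \<phi> (k + N)" for k
    using seq_suble[OF \<phi>(1), of "k + N"] by simp
  have "strict_mono \<psi>"
    unfolding strict_mono_def \<psi>_def
  proof (intro allI impI)
    fix i j :: nat assume "i < j"
    then have "\<phi> (i + N) < \<phi> (j + N)" using \<phi>(1) by (simp add: strict_mono_def)
    then show "\<phi> (i + N) - N < \<phi> (j + N) - N" using ge[of i] by simp
  qed
  moreover have "(\<lambda>k. X (\<psi> k + N)) \<longlonglongrightarrow> p"
    using LIMSEQ_ignore_initial_segment[OF \<phi>(2), of N] ge by (simp add: \<psi>_def)
  ultimately show ?thesis
    unfolding accumulation_point_def o_def by blast
qed

theorem theorem17:
  fixes f :: "real^'n \<Rightarrow> real"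
    and h :: "real^'n \<Rightarrow> real^'l"
    and G :: "real^'n \<Rightarrow> real^'m^'m"
    and run :: "nat \<Rightarrow> ('n, 'l, 'm) sqp_iterate"
    and \<epsilon> \<delta> \<eta> \<gamma> b1 b2 \<rho>star vlim :: real
    and \<Omega> :: "(real^'n) set"
  assumes G_symmetric: "\<And>x. symmetric_matrix (G x)"
    and constants: "\<epsilon> \<in> {0<..<1}" "\<delta> \<in> {0<..<1}" "\<eta> \<in> {0<..<1}" "\<gamma> \<in> {0<..<1}"
    and run: "sqp_infinite_run f h G \<epsilon> \<delta> \<eta> \<gamma> run"
    and A1: "C2 f" "C2 h" "C2 G"
    and A2: "convex \<Omega>" "compact \<Omega>" "\<And>k. it_x (run k) \<in> \<Omega>"
    and A3: "0 < b1" "b1 < b2"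
      "\<And>k. uniformly_elliptic b1 b2 (it_Bfea (run k))"
      "\<And>k. uniformly_elliptic b1 b2 (it_B (run k))"
    and rho_lim: "(\<lambda>k. it_rho (run k)) \<longlonglongrightarrow> \<rho>star" "\<rho>star > 0"
    and v_lim: "(\<lambda>k. violation h G (it_x (run k))) \<longlonglongrightarrow> vlim" "vlim > 0"
  shows "\<forall>xstar. accumulation_point (\<lambda>k. it_x (run k)) xstar \<longrightarrow>
           infeasible_stationary h G xstar \<and>
           (let (rstar, sstar, tstar) = least_shift h G xstar
            in shifted_KKT_point f h G rstar sstar tstar xstar)"
proof (intro allI impI)
  fix xstar assume acc: "accumulation_point (\<lambda>k. it_x (run k)) xstar"
  have steps: "sqp_step f h G \<epsilon> \<delta> \<eta> \<gamma> (run k) (it_x (run (Suc k))) (it_rho (run (Suc k)))" for k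
    using run by (simp add: sqp_infinite_run_def)
  define P where "P k \<longleftrightarrow> it_rho (run k) * (infnorm (it_muhat (run k)) + trace (it_Yhat (run k))) \<le> 1 \<and>
      \<epsilon> * lin_viol_red h G (it_x (run k)) (it_d (run k))
        \<le> lin_pen_red f h G (it_x (run k)) (it_rho (run k)) (it_d (run k))" for k
  have "it_rho (run (Suc k)) \<le> \<delta> * it_rho (run k) \<or> (it_rho (run (Suc k)) = it_rho (run k) \<and> P k)"
    if "0 < it_rho (run k)" for k
    using rho_next_cases[of \<delta> "run k" f h G \<epsilon>] that steps[of k] constants(2) by (auto simp: sqp_step_def P_def)
  then obtain N where N: "\<And>k. N \<le> k \<Longrightarrow> it_rho (run k) = \<rho>star \<and> P k"
    using eventually_no_geometric_reduction[OF rho_lim, of \<delta> P] constants(2) by auto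
  interpret stable_sqp_run f h G "\<lambda>k. run (k + N)" \<epsilon> \<delta> \<eta> \<gamma> b1 b2 \<rho>star \<Omega>
  proof
    fix k
    show "sqp_step f h G \<epsilon> \<delta> \<eta> \<gamma> (run (k + N)) (it_x (run (Suc k + N))) \<rho>star"
      using steps[of "k + N"] N[of "Suc (k + N)"] by simp
    show "it_rho (run (k + N)) = \<rho>star"
      "\<rho>star * (infnorm (it_muhat (run (k + N))) + trace (it_Yhat (run (k + N)))) \<le> 1"
      "\<epsilon> * lin_viol_red h G (it_x (run (k + N))) (it_d (run (k + N)))
        \<le> lin_pen_red f h G (it_x (run (k + N))) \<rho>star (it_d (run (k + N)))"
      using N[of "k + N"] by (auto simp: P_def)
  qed (use assms in auto)
  obtain \<phi> where \<phi>: "strict_mono \<phi>" "(\<lambda>k. it_x (run (\<phi> k))) \<longlonglongrightarrow> xstar"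
    using acc by (auto simp: accumulation_point_def o_def)
  have "(\<lambda>k. violation h G (it_x (run (\<phi> k)))) \<longlonglongrightarrow> violation h G xstar"
    by (rule tendsto_violation[OF A1(2,3) G_symmetric \<phi>(2)])
  moreover have "(\<lambda>k. violation h G (it_x (run (\<phi> k)))) \<longlonglongrightarrow> vlim"
    using LIMSEQ_subseq_LIMSEQ[OF v_lim(1) \<phi>(1)] by (simp add: o_def)
  ultimately have "0 < violation h G xstar"
    using v_lim(2) LIMSEQ_unique by metis
  with accumulation_point_stationary[OF accumulation_point_shift[OF acc, of N]]
  show "infeasible_stationary h G xstar \<and>
      (let (rstar, sstar, tstar) = least_shift h G xstar in shifted_KKT_point f h G rstar sstar tstar xstar)"
    by (simp add: least_shift_def)
qed

end
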